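(* Let $k\ge 3$ be a fixed integer. There exists $n_0=n_0(k)$ such that for every integer $n\ge n_0$, the polynomial \[ F_{n,k}(x)=\sum_{j=0}^{k} a_j c_j x^j,\qquad c_j=\binom{n}{j}\binom{n-j-1}{k-j}(-1)^{k-j}, \] is irreducible over $\mathbb{Q}$ for every choice of nonzero integers $a_0,a_1,\dots,a_k$ each of whose prime factors is $\le k$.
   Context: An integer "having all of its prime factors $\le k$" is a nonzero integer (possibly $\pm 1$) with no prime divisor exceeding $k$. *)

theory Defs
  imports "HOL-Computational_Algebra.Computational_Algebra"
begin

definition smooth_int :: "nat \<Rightarrow> int \<Rightarrow> bool" where
  "smooth_int k a \<longleftrightarrow> a \<noteq> 0 \<and> (\<forall>p \<in> prime_factors a. p \<le> int k)"

text \<open>The natural-number subtraction \<open>n - j - 1\<close> is the genuine one for \<open>j \<le> k\<close> as soon as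
  \<open>n > k\<close>; smaller \<open>n\<close> are irrelevant to a claim about all sufficiently large \<open>n\<close>.\<close>

definition c_coeff :: "nat \<Rightarrow> nat \<Rightarrow> nat \<Rightarrow> int" where
  "c_coeff n k j = int (n choose j) * int ((n - j - 1) choose (k - j)) * (-1) ^ (k - j)"

definition F_poly :: "(nat \<Rightarrow> int) \<Rightarrow> nat \<Rightarrow> nat \<Rightarrow> rat poly" where
  "F_poly a n k = (\<Sum>j\<le>k. monom (of_int (a j * c_coeff n k j)) j)"

end

theory Submission
  imports Defs "HOL-Number_Theory.Cong"
begin

text \<open>
  Suppose \<open>F = G H\<close> with \<open>0 < r = deg G < k\<close>, and let \<open>p > k\<close> be a prime with \<open>p\<close>-adic valuation
  \<open>e > 0\<close> at \<open>n - j\<close>. Since \<open>j! (k - j)! (n - j) c_j\<close> is up to sign \<open>n (n - 1) \<dots> (n - k)\<close>, every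
  coefficient of \<open>F\<close> has valuation \<open>e\<close>, except for the \<open>j\<close>-th one, which is a \<open>p\<close>-adic unit. The
  Newton polygon at \<open>j = 0\<close> and \<open>j = k\<close> shows that \<open>k\<close> divides \<open>e r\<close>. Hence \<open>n\<close> and \<open>n - k\<close> are
  \<open>d\<close>-th powers up to bounded factors, where \<open>d = k / gcd k r\<close>. If \<open>d = 2\<close>, then \<open>r = k / 2\<close>, and
  \<open>j = 1\<close>, \<open>j = k - 1\<close> show that \<open>n - 1\<close> and \<open>n - k + 1\<close> are \<open>(k - 1)\<close>-th powers up to bounded
  factors. Either way \<open>n\<close> is bounded, because \<open>a x^d - b y^d = c\<close> with \<open>d \<ge> 3\<close> and \<open>c \<noteq> 0\<close> has only
  finitely many solutions.

  The latter is Thue's theorem for binomial forms, proved here by his Pade approximation method: if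
  \<open>(x0, y0)\<close> is a solution, then \<open>a x0^d / (b y0^d)\<close> is close to \<open>1\<close>, and the diagonal Pade
  approximants of \<open>X^(1/d)\<close> at \<open>X = 1\<close> give a dense sequence of good rational approximations to
  the \<open>d\<close>-th root of \<open>b / a\<close>, so that no much larger solution can exist.
\<close>

subsection \<open>Pade approximants of the \<open>d\<close>-th root\<close>

definition divided_difference :: "real set \<Rightarrow> (real \<Rightarrow> real) \<Rightarrow> real" where
  "divided_difference A g = (\<Sum>i\<in>A. g i / (\<Prod>l\<in>A - {i}. i - l))"

text \<open>The factor \<open>x - a\<close> kills the term at \<open>a\<close> and cancels one
  factor in every other denominator.\<close>

lemma divided_difference_mult_linear:
  assumes "finite A" "a \<in> A"
  shows "divided_difference A (\<lambda>x. (x - a) * g x) = divided_difference (A - {a}) g"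
proof -
  have "(i - a) * g i / (\<Prod>l\<in>A - {i}. i - l) = g i / (\<Prod>l\<in>A - {a} - {i}. i - l)"
    if "i \<in> A - {a}" for i
  proof -
    have "A - {i} = insert a (A - {a} - {i})" using that assms by auto
    then have "(\<Prod>l\<in>A - {i}. i - l) = (i - a) * (\<Prod>l\<in>A - {a} - {i}. i - l)"
      using assms by (simp add: prod.insert)
    then show ?thesis using that by simp
  qed
  then show ?thesis
    using assms by (simp add: divided_difference_def sum.remove[of A a])
qed

text \<open>Since multiplication by \<open>x - a\<close> removes the node \<open>a\<close>, the
  value at \<open>x ^ Suc m\<close> reduces to values at \<open>x ^ m\<close> over \<open>A\<close>
  and over \<open>A - {a}\<close>. For \<open>m = 0\<close>, removing either of two distinct nodes
  gives the same result, which forces the value at the constant 1 to vanish.\<close>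

lemma divided_difference_power_eq_0:
  assumes "finite A" "m + 1 < card A"
  shows "divided_difference A (\<lambda>x. x ^ m) = 0"
  using assms
proof (induction "card A" arbitrary: A m rule: less_induct)
  case (less A)
  have lin: "divided_difference A (\<lambda>x. (x - a) * g x)
      = divided_difference A (\<lambda>x. x * g x) - a * divided_difference A g" for a g
    by (simp add: divided_difference_def sum_subtractf sum_distrib_left left_diff_distrib
        diff_divide_distrib)
  show ?case using less.prems(2)
  proof (induction m)
    case 0
    then have "2 \<le> card A" by simp
    then obtain a b where ab: "a \<in> A" "b \<in> A" "a \<noteq> b"
      using card_le_Suc0_iff_eq[OF less.prems(1)] by fastforce
    have "divided_difference (A - {a}) (\<lambda>x. 1) = divided_difference (A - {b}) (\<lambda>x. 1)"
    proof (cases "card A = 2")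
      case True
      then have "A = {a, b}" using ab by (metis card_2_iff insert_iff singletonD doubleton_eq_iff)
      then have "A - {a} = {b}" "A - {b} = {a}" using ab by auto
      then show ?thesis by (simp add: divided_difference_def)
    next
      case False
      then have "1 + 1 < card A" using \<open>2 \<le> card A\<close> by simp
      then show ?thesis
        using less.hyps[of "A - {a}" 0] less.hyps[of "A - {b}" 0] ab less.prems(1)
        by (simp add: card_Diff_singleton)
    qed
    moreover have "divided_difference (A - {u}) (\<lambda>x. 1)
        = divided_difference A (\<lambda>x. x) - u * divided_difference A (\<lambda>x. 1)" if "u \<in> A" for u
      using lin[of u "\<lambda>x. 1"] divided_difference_mult_linear[of A u "\<lambda>x. 1"] that less.prems(1)
      by simp
    ultimately have "a * divided_difference A (\<lambda>x. 1) = b * divided_difference A (\<lambda>x. 1)"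
      using ab by fastforce
    then show ?case using ab by simp
  next
    case (Suc m)
    then obtain a where a: "a \<in> A" by fastforce
    have "divided_difference (A - {a}) (\<lambda>x. x ^ m) = 0"
      using less.hyps[of "A - {a}" m] a less.prems(1) Suc.prems by (simp add: card_Diff_singleton)
    moreover have "divided_difference A (\<lambda>x. x ^ m) = 0"
      using Suc by simp
    ultimately show ?case
      using lin[of a "\<lambda>x. x ^ m"] divided_difference_mult_linear[of A a "\<lambda>x. x ^ m"] a less.prems(1)
      by simp
  qed
qed

section \<open>The weights of the Pade approximants and their moments\<close>

definition prog_plus :: "nat \<Rightarrow> nat \<Rightarrow> real" where
  "prog_plus d r = (\<Prod>m=1..r. real d * real m + 1)"

definition prog_minus :: "nat \<Rightarrow> nat \<Rightarrow> real" where
  "prog_minus d r = (\<Prod>m=1..r. real d * real m - 1)"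

text \<open>Up to sign and the factor \<open>d^(2 r) prog_plus d r prog_minus d r\<close>, which makes them integral,
  \<open>pade d r j\<close> and \<open>pade d r (r - j)\<close> are the weights \<open>1 / (\<Prod>l \<noteq> i. e_i - e_l)\<close> belonging to the
  nodes \<open>e_i = d j + 1\<close> and \<open>e_i = d j\<close> in the divided difference over all nodes \<open>d l\<close> and
  \<open>d l + 1\<close> with \<open>l \<le> r\<close>.\<close>

definition pade :: "nat \<Rightarrow> nat \<Rightarrow> nat \<Rightarrow> real" where
  "pade d r j = real d ^ r * (prog_plus d r / (prog_plus d j * fact (r - j)))
     * (prog_minus d r / (prog_minus d (r - j) * fact j))"

text \<open>Cuts a product over node differences at the distinguished index \<open>j\<close>:
  smaller indices give positive differences, larger ones negative differences, and
  \<open>h 0\<close> is the diagonal term.\<close>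

lemma prod_difference_split:
  fixes h :: "real \<Rightarrow> real"
  assumes "j \<le> r"
  shows "(\<Prod>l\<le>r. h (real j - real l)) = (\<Prod>m=1..j. h (real m)) * h 0 * (\<Prod>m=1..r-j. h (- real m))"
proof -
  have "{..r} = {..<j} \<union> {j} \<union> {j+1..r}" using assms by auto
  then have "(\<Prod>l\<le>r. h (real j - real l))
    = (\<Prod>l<j. h (real j - real l)) * h 0 * (\<Prod>l=j+1..r. h (real j - real l))"
    by (simp only:) (subst prod.union_disjoint; force?)+
  moreover have "(\<Prod>l<j. h (real j - real l)) = (\<Prod>m=1..j. h (real m))"
    by (rule prod.reindex_bij_witness[of _ "\<lambda>m. j - m" "\<lambda>l. j - l"]) (auto simp: of_nat_diff)
  moreover have "(\<Prod>l=j+1..r. h (real j - real l)) = (\<Prod>m=1..r-j. h (- real m))"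
    by (rule prod.reindex_bij_witness[of _ "\<lambda>m. j + m" "\<lambda>l. l - j"]) (auto simp: of_nat_diff)
  ultimately show ?thesis by simp
qed

lemma prod_uminus_interval:
  fixes h :: "nat \<Rightarrow> real"
  shows "(\<Prod>m=1..s. - h m) = (-1) ^ s * (\<Prod>m=1..s. h m)"
  by (simp add: prod_uminus)

lemma prog_plus_pos: "prog_plus d r > 0"
  unfolding prog_plus_def by (intro prod_pos) (auto intro: add_nonneg_pos)

lemma prog_minus_pos:
  assumes "d \<ge> 2"
  shows "prog_minus d r > 0"
  unfolding prog_minus_def
proof (intro prod_pos)
  fix m assume "m \<in> {1..r}"
  with assms have "2 * 1 \<le> real d * real m" by (intro mult_mono) auto
  then show "0 < real d * real m - 1" by simp
qed

text \<open>The divided difference over the \<open>2 * r + 2\<close> nodes \<open>d j\<close> and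
  \<open>d j + 1\<close> annihilates \<open>x ^ m\<close> for \<open>m \<le> 2 * r\<close>; after
  scaling, the nodes \<open>d j + 1\<close> contribute the left sum and the nodes \<open>d j\<close>
  minus the right sum. These identities will cancel the Taylor coefficients of the remainder up to
  degree \<open>2 * r\<close>.\<close>

lemma pade_moment:
  assumes d: "d \<ge> 2" and m: "m \<le> 2 * r"
  shows "(\<Sum>j\<le>r. pade d r j * (real d * real j + 1) ^ m)
       = (\<Sum>j\<le>r. pade d r (r - j) * (real d * real j) ^ m)"
proof -
  define f1 f0 where "f1 = (\<lambda>j::nat. real d * real j + 1)" and "f0 = (\<lambda>j::nat. real d * real j)"
  define S1 S0 where "S1 = f1 ` {..r}" and "S0 = f0 ` {..r}"
  define A where "A = S1 \<union> S0"
  have inj: "inj_on f1 X" "inj_on f0 X" for X using d by (auto simp: inj_on_def f1_def f0_def)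
  have ne: "f1 i \<noteq> f0 j" for i j
  proof
    assume "f1 i = f0 j"
    then have "real (d * i + 1) = real (d * j)" by (simp add: f1_def f0_def)
    then have "d * i + 1 = d * j" using of_nat_eq_iff by blast
    then have "d dvd 1" by (metis dvd_add_right_iff dvd_triv_left)
    then show False using d by simp
  qed
  have disj: "S1 \<inter> S0 = {}" using ne by (auto simp: S1_def S0_def)
  have fin: "finite S1" "finite S0" by (auto simp: S1_def S0_def)
  have card: "card A = 2 * r + 2"
    using disj fin inj by (simp add: A_def card_Un_disjoint S1_def S0_def card_image)
  define C where "C j = real d ^ r * fact j * fact (r - j)" for j
  have same: "(\<Prod>l\<in>{..r} - {j}. real d * (real j - real l)) = (-1) ^ (r - j) * C j"
    if j: "j \<le> r" for j
  proof -
    \<comment> \<open>Assigning the value 1 to the difference 0 lets \<open>l\<close> run over all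
      indices, as \<open>prod_difference_split\<close> requires.\<close>
    have "(\<Prod>l\<in>{..r} - {j}. real d * (real j - real l))
        = (\<Prod>l\<le>r. (\<lambda>x. if x = 0 then 1 else real d * x) (real j - real l))"
      by (rule prod.mono_neutral_cong_left) auto
    also have "\<dots> = (\<Prod>m=1..j. real d * real m) * (\<Prod>m=1..r-j. - (real d * real m))"
      by (subst prod_difference_split[OF j]) simp
    also have "\<dots> = (-1) ^ (r - j) * (\<Prod>m=1..j. real d * real m) * (\<Prod>m=1..r-j. real d * real m)"
      by (simp only: prod_uminus_interval) simp
    also have "\<dots> = (-1) ^ (r - j) * (real d ^ j * fact j) * (real d ^ (r - j) * fact (r - j))"
      by (simp add: prod.distrib fact_prod)
    also have "\<dots> = (-1) ^ (r - j) * C j"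
      using j by (simp add: C_def power_add[symmetric])
    finally show ?thesis .
  qed
  have p1: "(\<Prod>l\<in>A - {f1 j}. f1 j - l) = C j * prog_plus d j * prog_minus d (r - j)"
    if j: "j \<le> r" for j
  proof -
    have "A - {f1 j} = f1 ` ({..r} - {j}) \<union> S0"
      using ne inj(1)[of UNIV] by (auto simp: A_def S1_def S0_def inj_on_def)
    moreover have "f1 ` ({..r} - {j}) \<inter> S0 = {}" using ne by (auto simp: S0_def)
    ultimately have "(\<Prod>l\<in>A - {f1 j}. f1 j - l)
        = (\<Prod>l\<in>{..r} - {j}. f1 j - f1 l) * (\<Prod>l\<le>r. f1 j - f0 l)"
      using fin inj by (simp add: prod.union_disjoint S0_def prod.reindex)
    also have "(\<Prod>l\<in>{..r} - {j}. f1 j - f1 l) = (-1) ^ (r - j) * C j"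
      using same[OF j] by (simp add: f1_def algebra_simps)
    also have "(\<Prod>l\<le>r. f1 j - f0 l) = (\<Prod>l\<le>r. (\<lambda>x. real d * x + 1) (real j - real l))"
      by (simp add: f1_def f0_def algebra_simps)
    also have "\<dots> = prog_plus d j * (\<Prod>m=1..r-j. - (real d * real m - 1))"
      by (subst prod_difference_split[OF j]) (simp add: prog_plus_def)
    also have "\<dots> = prog_plus d j * ((-1) ^ (r - j) * prog_minus d (r - j))"
      by (simp only: prod_uminus_interval prog_minus_def)
    finally show ?thesis by (simp add: power_add[symmetric] power_mult_distrib[symmetric])
  qed
  \<comment> \<open>The minus sign is the diagonal difference \<open>f0 j - f1 j = - 1\<close>; the
    two factors \<open>(-1) ^ (r - j)\<close> cancel.\<close>
  have p0: "(\<Prod>l\<in>A - {f0 j}. f0 j - l) = - (C j * prog_minus d j * prog_plus d (r - j))"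
    if j: "j \<le> r" for j
  proof -
    have "A - {f0 j} = S1 \<union> f0 ` ({..r} - {j})"
      using ne inj(2)[of UNIV] by (auto simp: A_def S1_def S0_def inj_on_def) (metis ne)+
    moreover have "S1 \<inter> f0 ` ({..r} - {j}) = {}" using ne by (auto simp: S1_def)
    ultimately have "(\<Prod>l\<in>A - {f0 j}. f0 j - l)
        = (\<Prod>l\<le>r. f0 j - f1 l) * (\<Prod>l\<in>{..r} - {j}. f0 j - f0 l)"
      using fin inj by (simp add: prod.union_disjoint S1_def prod.reindex)
    also have "(\<Prod>l\<in>{..r} - {j}. f0 j - f0 l) = (-1) ^ (r - j) * C j"
      using same[OF j] by (simp add: f0_def algebra_simps)
    also have "(\<Prod>l\<le>r. f0 j - f1 l) = (\<Prod>l\<le>r. (\<lambda>x. real d * x - 1) (real j - real l))"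
      by (simp add: f1_def f0_def algebra_simps)
    also have "\<dots> = - prog_minus d j * (\<Prod>m=1..r-j. - (real d * real m + 1))"
      by (subst prod_difference_split[OF j]) (simp add: prog_minus_def)
    also have "\<dots> = - prog_minus d j * ((-1) ^ (r - j) * prog_plus d (r - j))"
      by (simp only: prod_uminus_interval prog_plus_def)
    finally show ?thesis by (simp add: power_add[symmetric] power_mult_distrib[symmetric])
  qed
  define M where "M = real d ^ r * real d ^ r * prog_plus d r * prog_minus d r"
  have pos: "prog_plus d i > 0" "prog_minus d i > 0" for i
    using prog_plus_pos prog_minus_pos d by auto
  have w1: "M / (C j * prog_plus d j * prog_minus d (r - j)) = pade d r j" if "j \<le> r" for j
    using d pos[of j] pos[of "r-j"] by (simp add: M_def C_def pade_def field_simps mult_2 power_add)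
  have w0: "M / (C j * prog_minus d j * prog_plus d (r - j)) = pade d r (r - j)" if "j \<le> r" for j
    using that d pos[of j] pos[of "r-j"]
    by (simp add: M_def C_def pade_def field_simps mult_2 power_add)
  have "0 = M * divided_difference A (\<lambda>x. x ^ m)"
    using divided_difference_power_eq_0[of A m] card m fin by (simp add: A_def)
  also have "divided_difference A (\<lambda>x. x ^ m)
     = (\<Sum>j\<le>r. f1 j ^ m / (\<Prod>l\<in>A - {f1 j}. f1 j - l)) + (\<Sum>j\<le>r. f0 j ^ m / (\<Prod>l\<in>A - {f0 j}. f0 j - l))"
    unfolding divided_difference_def
    by (subst (1) A_def, subst sum.union_disjoint[OF fin disj])
       (simp add: S1_def S0_def sum.reindex inj o_def)
  also have "M * \<dots> = (\<Sum>j\<le>r. M / (C j * prog_plus d j * prog_minus d (r - j)) * f1 j ^ m)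
      - (\<Sum>j\<le>r. M / (C j * prog_minus d j * prog_plus d (r - j)) * f0 j ^ m)"
    by (simp add: p1 p0 right_diff_distrib sum_distrib_left sum_negf)
  also have "\<dots> = (\<Sum>j\<le>r. pade d r j * f1 j ^ m) - (\<Sum>j\<le>r. pade d r (r - j) * f0 j ^ m)"
    by (simp add: w1 w0)
  finally show ?thesis by (simp add: f1_def f0_def)
qed

section \<open>Integrality and size of the weights\<close>

text \<open>Only multiples of \<open>p\<close> contribute, so with \<open>q = s div p\<close> the
  multiplicity is \<open>q\<close> plus that in \<open>fact q\<close>, at most
  \<open>2 * q \<le> s\<close> by induction.\<close>

lemma multiplicity_fact_le:
  fixes p :: nat
  assumes p: "prime p"
  shows "multiplicity p (fact s) \<le> s"
proof (induction s rule: less_induct)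
  case (less s)
  have fm: "multiplicity p (fact t) = (\<Sum>m=1..t. multiplicity p m)" for t :: nat
    using p by (simp add: fact_prod prime_elem_multiplicity_prod_distrib)
  show ?case
  proof (cases "s = 0")
    case False
    define q where "q = s div p"
    have "2 \<le> p" using p by (simp add: prime_ge_2_nat)
    then have qs: "q < s" using False by (simp add: q_def)
    have "2 * q \<le> p * q" using \<open>2 \<le> p\<close> by simp
    then have q2: "2 * q \<le> s" unfolding q_def by (meson le_trans times_div_less_eq_dividend)
    have "multiplicity p (fact s) = (\<Sum>m=1..s. multiplicity p m)" by (rule fm)
    also have "\<dots> = (\<Sum>m\<in>(\<lambda>i. p * i) ` {1..q}. multiplicity p m)"
    proof (rule sum.mono_neutral_right)
      show "(\<lambda>i. p * i) ` {1..q} \<subseteq> {1..s}"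
        using \<open>2 \<le> p\<close> by (auto simp: q_def less_eq_div_iff_mult_less_eq mult.commute)
      show "\<forall>m\<in>{1..s} - (\<lambda>i. p * i) ` {1..q}. multiplicity p m = 0"
      proof
        fix m assume m: "m \<in> {1..s} - (\<lambda>i. p * i) ` {1..q}"
        have "\<not> p dvd m"
        proof
          assume "p dvd m"
          then obtain i where i: "m = p * i" ..
          then have "i \<in> {1..q}"
            using m \<open>2 \<le> p\<close> by (auto simp: q_def less_eq_div_iff_mult_less_eq mult.commute Suc_le_eq)
          then show False using m i by auto
        qed
        then show "multiplicity p m = 0" by (simp add: not_dvd_imp_multiplicity_0)
      qed
    qed auto
    also have "\<dots> = (\<Sum>i=1..q. multiplicity p (p * i))"
      using \<open>2 \<le> p\<close> by (subst sum.reindex) (auto simp: inj_on_def)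
    also have "\<dots> = (\<Sum>i=1..q. 1 + multiplicity p i)"
      using p by (intro sum.cong refl) (subst multiplicity_times_same; auto)
    also have "\<dots> = q + multiplicity p (fact q)"
      by (simp only: fm sum.distrib) simp
    also have "\<dots> \<le> q + q" using less.IH[OF qs] by simp
    also have "\<dots> \<le> s" using q2 by simp
    finally show ?thesis .
  qed simp
qed

text \<open>Checked prime by prime. If \<open>p\<close> divides \<open>d\<close>, the power
  \<open>d ^ s\<close> absorbs the at most \<open>s\<close> factors \<open>p\<close> of
  \<open>fact s\<close>. Otherwise \<open>d\<close> is invertible modulo \<open>p ^ v\<close>, and
  the progression is congruent to \<open>d ^ s\<close> times \<open>s\<close> consecutive integers,
  whose product is divisible by \<open>fact s\<close>.\<close>

lemma fact_dvd_power_mult_progression: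
  fixes a d s :: nat
  assumes "d > 0"
  shows "fact s dvd d ^ s * (\<Prod>i<s. a + d * i)"
proof (cases "(\<Prod>i<s. a + d * i) = 0")
  case False
  show ?thesis
  proof (rule multiplicity_le_imp_dvd)
    fix p :: nat assume p: "prime p"
    define v where "v = multiplicity p (fact s :: nat)"
    have v: "p ^ v dvd fact s" unfolding v_def by (rule multiplicity_dvd)
    have "p ^ v dvd d ^ s * (\<Prod>i<s. a + d * i)"
    proof (cases "p dvd d")
      case True
      have "p ^ v dvd p ^ s" using multiplicity_fact_le[OF p, of s] by (simp add: v_def le_imp_power_dvd)
      also have "p ^ s dvd d ^ s" using True by (rule dvd_power_same)
      finally show ?thesis by simp
    next
      case False
      then have "coprime d (p ^ v)" using p prime_imp_coprime_nat[of p d] by (simp add: coprime_commute)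
      then obtain d' where d': "[d * d' = 1] (mod p ^ v)"
        using cong_solve_coprime_nat[of d "p ^ v"] by auto
      have "[d * (a * d' + i) = a + d * i] (mod p ^ v)" for i
      proof -
        have "[a * (d * d') + d * i = a * 1 + d * i] (mod p ^ v)"
          by (intro cong_add cong_mult d' cong_refl)
        then show ?thesis by (simp add: algebra_simps)
      qed
      then have "[(\<Prod>i<s. d * (a * d' + i)) = (\<Prod>i<s. a + d * i)] (mod p ^ v)"
        by (intro cong_prod)
      moreover have "fact s dvd (\<Prod>i<s. a * d' + i)"
      proof -
        have "int (fact s) dvd pochhammer (int (a * d')) s"
          using fact_dvd_pochhammer[of s "int (a * d')"] by simp
        also have "\<dots> = int (\<Prod>i<s. a * d' + i)"
          by (simp add: pochhammer_prod atLeast0LessThan)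
        finally show ?thesis by (simp only: of_nat_dvd_iff)
      qed
      then have "p ^ v dvd (\<Prod>i<s. d * (a * d' + i))"
        unfolding prod.distrib using v by (meson dvd_mult dvd_trans)
      ultimately have "p ^ v dvd (\<Prod>i<s. a + d * i)"
        using cong_dvd_iff by blast
      then show ?thesis by simp
    qed
    then show "multiplicity p (fact s) \<le> multiplicity p (d ^ s * (\<Prod>i<s. a + d * i))"
      using False assms p by (subst (asm) power_dvd_iff_le_multiplicity) (auto simp: v_def)
  qed (use False in auto)
next
  case True
  then show ?thesis by (simp only: mult_0_right dvd_0_right)
qed

lemma prog_plus_split:
  assumes "j \<le> r"
  shows "prog_plus d r = prog_plus d j * real (\<Prod>i<r-j. (d * (j + 1) + 1) + d * i)"
proof -
  have "{1..r} = {1..j} \<union> {j+1..r}" using assms by auto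
  then have "prog_plus d r = prog_plus d j * (\<Prod>m=j+1..r. real d * real m + 1)"
    unfolding prog_plus_def by (simp only:) (subst prod.union_disjoint; auto)
  also have "(\<Prod>m=j+1..r. real d * real m + 1) = (\<Prod>i<r-j. real d * real (j + 1 + i) + 1)"
    by (rule prod.reindex_bij_witness[of _ "\<lambda>i. j + 1 + i" "\<lambda>m. m - (j + 1)"]) auto
  finally show ?thesis by (simp add: algebra_simps)
qed

lemma prog_minus_split:
  assumes "j \<le> r" "d > 0"
  shows "prog_minus d r = prog_minus d j * real (\<Prod>i<r-j. (d * (j + 1) - 1) + d * i)"
proof -
  have "{1..r} = {1..j} \<union> {j+1..r}" using assms by auto
  then have "prog_minus d r = prog_minus d j * (\<Prod>m=j+1..r. real d * real m - 1)"
    unfolding prog_minus_def by (simp only:) (subst prod.union_disjoint; auto)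
  also have "(\<Prod>m=j+1..r. real d * real m - 1) = (\<Prod>i<r-j. real d * real (j + 1 + i) - 1)"
    by (rule prod.reindex_bij_witness[of _ "\<lambda>i. j + 1 + i" "\<lambda>m. m - (j + 1)"]) auto
  finally show ?thesis using assms by (simp add: algebra_simps of_nat_diff)
qed

lemma prod_shift_eq_fact:
  "(\<Prod>i<s. real (j + 1 + i)) = fact (j + s) / fact j"
proof (induction s)
  case (Suc s)
  then show ?case by (simp add: add_ac)
qed simp

text \<open>After cancellation each quotient in \<open>pade\<close> is a product along a progression
  of difference \<open>d\<close> over a factorial. Splitting \<open>d ^ r\<close> as
  \<open>d ^ (r - j) * d ^ j\<close> between them makes both integral, and comparing the
  progressions with multiples of consecutive integers yields the binomial coefficients.\<close>

lemma pade_factors: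
  assumes d: "d \<ge> 2" and j: "j \<le> r"
  obtains u v :: nat where "pade d r j = real u * real v"
    "real u \<le> real (d * (2 * d)) ^ (r - j) * real (r choose j)"
    "real v \<le> real (d * d) ^ j * real (r choose j)"
proof -
  define s where "s = r - j"
  define A where "A = (\<Prod>i<s. (d * (j + 1) + 1) + d * i)"
  define B where "B = (\<Prod>i<j. (d * (s + 1) - 1) + d * i)"
  obtain u where u: "d ^ s * A = fact s * u"
    using fact_dvd_power_mult_progression[of d s "d * (j + 1) + 1"] d by (auto simp: A_def)
  obtain v where v: "d ^ j * B = fact j * v"
    using fact_dvd_power_mult_progression[of d j "d * (s + 1) - 1"] d by (auto simp: B_def)
  have ur: "real u = real d ^ s * real A / fact s"
    using arg_cong[OF u, of real] by (simp add: field_simps)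
  have vr: "real v = real d ^ j * real B / fact j"
    using arg_cong[OF v, of real] by (simp add: field_simps)
  have rs: "r - s = j" "s \<le> r" "s + j = r" using j by (auto simp: s_def)
  have "prog_plus d r = prog_plus d j * real A"
    using prog_plus_split[OF j, of d] by (simp only: A_def s_def)
  moreover have "prog_minus d r = prog_minus d s * real B"
    using prog_minus_split[OF rs(2), of d] d by (simp only: B_def rs)
  moreover have "prog_plus d j > 0" "prog_minus d s > 0"
    using d prog_plus_pos prog_minus_pos by auto
  ultimately have "pade d r j = real d ^ r * (real A / fact s) * (real B / fact j)"
    unfolding pade_def s_def[symmetric] by simp
  also have "real d ^ r = real d ^ s * real d ^ j"
    using rs(3) by (simp flip: power_add)
  finally have "pade d r j = real u * real v"
    unfolding ur vr by simp
  moreover have "real u \<le> real (d * (2 * d)) ^ (r - j) * real (r choose j)"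
  proof -
    have "real A \<le> (\<Prod>i<s. real (2 * d) * real (j + 1 + i))"
      unfolding A_def of_nat_prod
    proof (rule prod_mono, safe)
      fix i
      have "1 \<le> d * (j + 1 + i)" using d by simp
      then have "(d * (j + 1) + 1) + d * i \<le> 2 * d * (j + 1 + i)" by (simp add: algebra_simps)
      then show "real ((d * (j + 1) + 1) + d * i) \<le> real (2 * d) * real (j + 1 + i)"
        by (metis of_nat_le_iff of_nat_mult)
    qed auto
    also have "\<dots> = real (2 * d) ^ s * (fact r / fact j)"
      using rs by (simp only: prod.distrib prod_shift_eq_fact) (simp add: add.commute)
    finally have "real u \<le> real d ^ s * (real (2 * d) ^ s * (fact r / fact j)) / fact s"
      unfolding ur by (intro divide_right_mono mult_left_mono) auto
    also have "\<dots> = real (d * (2 * d)) ^ s * (fact r / (fact j * fact s))"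
      by (simp add: power_mult_distrib field_simps)
    also have "fact r / (fact j * fact s) = real (r choose j)"
      using j by (simp add: binomial_fact s_def)
    finally show ?thesis by (simp add: s_def)
  qed
  moreover have "real v \<le> real (d * d) ^ j * real (r choose j)"
  proof -
    have "real B \<le> (\<Prod>i<j. real d * real (s + 1 + i))"
      unfolding B_def of_nat_prod
    proof (rule prod_mono, safe)
      fix i
      have "(d * (s + 1) - 1) + d * i \<le> d * (s + 1 + i)" by (simp add: algebra_simps)
      then show "real ((d * (s + 1) - 1) + d * i) \<le> real d * real (s + 1 + i)"
        by (metis of_nat_le_iff of_nat_mult)
    qed auto
    also have "\<dots> = real d ^ j * (fact r / fact s)"
      using rs by (simp only: prod.distrib prod_shift_eq_fact) simp
    finally have "real v \<le> real d ^ j * (real d ^ j * (fact r / fact s)) / fact j"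
      unfolding vr by (intro divide_right_mono mult_left_mono) auto
    also have "\<dots> = real (d * d) ^ j * (fact r / (fact j * fact s))"
      by (simp add: power_mult_distrib field_simps)
    also have "fact r / (fact j * fact s) = real (r choose j)"
      using j by (simp add: binomial_fact s_def)
    finally show ?thesis .
  qed
  ultimately show thesis by (rule that)
qed

text \<open>The base \<open>8 * d\<^sup>2\<close> consists of \<open>2 * d\<^sup>2\<close>, the
  larger base in \<open>pade_factors\<close>, and of 4 for two binomial coefficients of size at most
  \<open>2 ^ r\<close>.\<close>

lemma pade_bounds:
  assumes d: "d \<ge> 2" and j: "j \<le> r"
  shows "pade d r j \<in> \<nat>" "0 < pade d r j" "pade d r j \<le> real (8 * d\<^sup>2) ^ r"
proof -
  show "0 < pade d r j"
    unfolding pade_def using d prog_plus_pos prog_minus_pos by (auto intro!: mult_pos_pos divide_pos_pos)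
  from d j obtain u v :: nat where uv: "pade d r j = real u * real v"
    "real u \<le> real (d * (2 * d)) ^ (r - j) * real (r choose j)"
    "real v \<le> real (d * d) ^ j * real (r choose j)" by (rule pade_factors)
  then show "pade d r j \<in> \<nat>" by simp
  have c: "real (r choose j) \<le> 2 ^ r"
    using binomial_le_pow2[of r j] of_nat_mono[where 'a=real] by fastforce
  have "real u * real v
      \<le> (real (d * (2 * d)) ^ (r - j) * real (r choose j)) * (real (d * d) ^ j * real (r choose j))"
    by (intro mult_mono uv) auto
  also have "\<dots> \<le> (real (d * (2 * d)) ^ (r - j) * 2 ^ r) * (real (d * (2 * d)) ^ j * 2 ^ r)"
    by (intro mult_mono c power_mono) auto
  also have "\<dots> = real (d * (2 * d)) ^ r * (2 ^ r * 2 ^ r)"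
    using power_add[of "real (d * (2 * d))" "r - j" j] j by (simp only: le_add_diff_inverse2 mult_ac)
  also have "\<dots> = real (8 * d\<^sup>2) ^ r"
  proof -
    have "real (8 * d\<^sup>2) = real (d * (2 * d)) * (2 * 2)" by (simp add: power2_eq_square)
    then show ?thesis by (simp only: power_mult_distrib)
  qed
  finally show "pade d r j \<le> real (8 * d\<^sup>2) ^ r" using uv(1) by simp
qed

section \<open>The approximants, their remainder and their independence\<close>

text \<open>The quotient \<open>padeQ d r / padeP d r\<close> is the diagonal Pade approximant of
  the \<open>d\<close>-th root of \<open>x\<close> at \<open>x = 1\<close>; the coefficients of one
  polynomial are those of the other reversed.\<close>

definition padeP :: "nat \<Rightarrow> nat \<Rightarrow> real poly" where
  "padeP d r = (\<Sum>j\<le>r. monom (pade d r j) j)"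

definition padeQ :: "nat \<Rightarrow> nat \<Rightarrow> real poly" where
  "padeQ d r = (\<Sum>j\<le>r. monom (pade d r (r - j)) j)"

text \<open>The three factors account for the \<open>2 * (r + 1)\<close> summands of the remainder,
  the size of the weights, and the Taylor remainders of the exponentials.\<close>

definition pade_const :: "nat \<Rightarrow> real" where
  "pade_const d = 2 * real (8 * d\<^sup>2) * exp (2 * (real d + 1))"

lemma poly_padeP: "poly (padeP d r) x = (\<Sum>j\<le>r. pade d r j * x ^ j)"
  by (simp add: padeP_def poly_sum poly_monom)

lemma poly_padeQ: "poly (padeQ d r) x = (\<Sum>j\<le>r. pade d r (r - j) * x ^ j)"
  by (simp add: padeQ_def poly_sum poly_monom)

lemma power_div_fact_le_exp:
  fixes x :: real
  assumes "0 \<le> x"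
  shows "x ^ n / fact n \<le> exp x"
proof -
  obtain t where "exp x = (\<Sum>m<Suc n. x ^ m / fact m) + exp t / fact (Suc n) * x ^ Suc n"
    using Maclaurin_exp_le[of x "Suc n"] by auto
  moreover have "0 \<le> (\<Sum>m<n. x ^ m / fact m)" "0 \<le> exp t / fact (Suc n) * x ^ Suc n"
    using assms by (auto intro!: sum_nonneg)
  ultimately show ?thesis by simp
qed

lemma exp_taylor_remainder:
  fixes u :: real
  shows "\<bar>exp u - (\<Sum>m<n. u ^ m / fact m)\<bar> \<le> \<bar>u\<bar> ^ n / fact n * exp \<bar>u\<bar>"
proof -
  obtain t where t: "\<bar>t\<bar> \<le> \<bar>u\<bar>" "exp u = (\<Sum>m<n. u ^ m / fact m) + exp t / fact n * u ^ n"
    using Maclaurin_exp_le[of u n] by auto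
  then have "\<bar>exp u - (\<Sum>m<n. u ^ m / fact m)\<bar> = exp t * (\<bar>u\<bar> ^ n / fact n)"
    by (simp add: abs_mult power_abs)
  also have "\<dots> \<le> exp \<bar>u\<bar> * (\<bar>u\<bar> ^ n / fact n)"
    using t(1) by (intro mult_right_mono) auto
  finally show ?thesis by (simp add: mult.commute)
qed

lemma Suc_le_two_power: "real r + 1 \<le> 2 ^ r"
proof -
  have "r + 1 \<le> 2 ^ r" by (induction r) auto
  then have "real (r + 1) \<le> real (2 ^ r)" by (simp only: of_nat_le_iff)
  then show ?thesis by simp
qed

text \<open>With \<open>x = exp (d * L)\<close> the \<open>d\<close>-th root is
  \<open>exp L\<close>, and both terms become weighted sums of \<open>exp (L * e)\<close> over the
  nodes \<open>e\<close>. By \<open>pade_moment\<close> the Taylor polynomials of degree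
  \<open>2 * r\<close> cancel, so only Taylor remainders of order \<open>2 * r + 1\<close>
  survive.\<close>

lemma pade_remainder:
  assumes d: "d \<ge> 2" and L: "\<bar>L\<bar> \<le> 1"
  shows "\<bar>exp L * poly (padeP d r) (exp (real d * L)) - poly (padeQ d r) (exp (real d * L))\<bar>
     \<le> pade_const d ^ (r + 1) * \<bar>L\<bar> ^ (2 * r + 1)"
proof -
  define n where "n = 2 * r + 1"
  define c where "c = real d * real r + 1"
  define T where "T u = (\<Sum>m<n. u ^ m / fact m)" for u :: real
  define R where "R u = exp u - T u" for u
  define B where "B = \<bar>L\<bar> ^ n * exp (2 * c)"
  have c0: "c \<ge> 0" by (simp add: c_def)
  have R: "\<bar>R (L * e)\<bar> \<le> B" if e: "0 \<le> e" "e \<le> c" for e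
  proof -
    have "\<bar>R (L * e)\<bar> \<le> \<bar>L * e\<bar> ^ n / fact n * exp \<bar>L * e\<bar>"
      unfolding R_def T_def by (rule exp_taylor_remainder)
    also have "\<dots> = \<bar>L\<bar> ^ n * (e ^ n / fact n * exp (\<bar>L\<bar> * e))"
      using e by (simp add: abs_mult power_mult_distrib)
    also have "\<dots> \<le> \<bar>L\<bar> ^ n * (exp c * exp c)"
    proof (intro mult_left_mono mult_mono)
      \<comment> \<open>The factorial offsets the power of the node, which keeps the bound merely
        exponential in \<open>r\<close>.\<close>
      have "e ^ n / fact n \<le> exp e" using e by (intro power_div_fact_le_exp)
      also have "\<dots> \<le> exp c" using e by simp
      finally show "e ^ n / fact n \<le> exp c" .
      have "\<bar>L\<bar> * e \<le> 1 * c" using L e by (intro mult_mono) auto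
      then show "exp (\<bar>L\<bar> * e) \<le> exp c" by simp
    qed (use e in auto)
    also have "\<dots> = B" by (simp add: B_def exp_add[symmetric])
    finally show ?thesis .
  qed
  have moments: "(\<Sum>j\<le>r. pade d r j * T (L * (real d * real j + 1)))
      = (\<Sum>j\<le>r. pade d r (r - j) * T (L * (real d * real j)))"
  proof -
    have sw: "(\<Sum>j\<le>r. w j * T (L * e j)) = (\<Sum>m<n. L ^ m / fact m * (\<Sum>j\<le>r. w j * e j ^ m))" for w e
      unfolding T_def sum_distrib_left
      by (subst sum.swap) (simp add: power_mult_distrib mult_ac)
    show ?thesis unfolding sw
      by (intro sum.cong refl) (use pade_moment[OF d] in \<open>auto simp: n_def\<close>)
  qed
  have "exp L * poly (padeP d r) (exp (real d * L))
      = (\<Sum>j\<le>r. pade d r j * exp (L * (real d * real j + 1)))"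
    unfolding poly_padeP sum_distrib_left
    by (intro sum.cong refl) (simp add: exp_of_nat_mult[symmetric] exp_add[symmetric] algebra_simps)
  moreover have "poly (padeQ d r) (exp (real d * L))
      = (\<Sum>j\<le>r. pade d r (r - j) * exp (L * (real d * real j)))"
    unfolding poly_padeQ
    by (intro sum.cong refl) (simp add: exp_of_nat_mult[symmetric] algebra_simps)
  ultimately have eq: "exp L * poly (padeP d r) (exp (real d * L)) - poly (padeQ d r) (exp (real d * L))
      = (\<Sum>j\<le>r. pade d r j * R (L * (real d * real j + 1)))
        - (\<Sum>j\<le>r. pade d r (r - j) * R (L * (real d * real j)))"
    using moments by (simp add: R_def right_diff_distrib sum_subtractf)
  have S: "\<bar>\<Sum>j\<le>r. w j * R (L * e j)\<bar> \<le> (real r + 1) * (real (8 * d\<^sup>2) ^ r * B)"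
    if "\<And>j. j \<le> r \<Longrightarrow> 0 \<le> e j \<and> e j \<le> c"
      "\<And>j. j \<le> r \<Longrightarrow> 0 \<le> w j \<and> w j \<le> real (8 * d\<^sup>2) ^ r" for w e
  proof -
    have "\<bar>\<Sum>j\<le>r. w j * R (L * e j)\<bar> \<le> (\<Sum>j\<le>r. \<bar>w j * R (L * e j)\<bar>)" by (rule sum_abs)
    also have "\<dots> \<le> (\<Sum>j\<le>r. real (8 * d\<^sup>2) ^ r * B)"
    proof (rule sum_mono)
      fix j assume "j \<in> {..r}"
      then show "\<bar>w j * R (L * e j)\<bar> \<le> real (8 * d\<^sup>2) ^ r * B"
        unfolding abs_mult by (intro mult_mono) (use that R in auto)
    qed
    finally show ?thesis by (simp add: add.commute)
  qed
  have "\<bar>\<Sum>j\<le>r. pade d r j * R (L * (real d * real j + 1))\<bar> \<le> (real r + 1) * (real (8 * d\<^sup>2) ^ r * B)"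
    by (rule S) (use pade_bounds[OF d] in \<open>auto simp: c_def less_imp_le mult_left_mono\<close>)
  moreover have "\<bar>\<Sum>j\<le>r. pade d r (r - j) * R (L * (real d * real j))\<bar> \<le> (real r + 1) * (real (8 * d\<^sup>2) ^ r * B)"
  proof (rule S)
    fix j assume "j \<le> r"
    then have "real d * real j \<le> real d * real r" by (intro mult_left_mono) auto
    then show "0 \<le> real d * real j \<and> real d * real j \<le> c" by (simp add: c_def)
  qed (use pade_bounds[OF d] in \<open>auto simp: less_imp_le\<close>)
  ultimately have "\<bar>exp L * poly (padeP d r) (exp (real d * L)) - poly (padeQ d r) (exp (real d * L))\<bar>
      \<le> 2 * (real r + 1) * (real (8 * d\<^sup>2) ^ r * B)"
    unfolding eq by linarith
  also have "\<dots> \<le> 2 ^ (r + 1) * (real (8 * d\<^sup>2) ^ (r + 1) * (\<bar>L\<bar> ^ n * exp (2 * (real d + 1)) ^ (r + 1)))"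
  proof (intro mult_mono)
    show "2 * (real r + 1) \<le> 2 ^ (r + 1)" using Suc_le_two_power[of r] by simp
    have "1 \<le> d\<^sup>2" using d by (simp add: Suc_le_eq)
    then have "1 \<le> real (8 * d\<^sup>2)" by linarith
    then show "real (8 * d\<^sup>2) ^ r \<le> real (8 * d\<^sup>2) ^ (r + 1)" by (intro power_increasing) auto
    have "2 * c \<le> real (r + 1) * (2 * (real d + 1))"
      by (simp add: c_def algebra_simps)
    then show "B \<le> \<bar>L\<bar> ^ n * exp (2 * (real d + 1)) ^ (r + 1)"
      unfolding B_def exp_of_nat_mult[symmetric] by (intro mult_left_mono) auto
  qed (auto simp: B_def)
  also have "\<dots> = pade_const d ^ (r + 1) * \<bar>L\<bar> ^ n"
    unfolding pade_const_def power_mult_distrib by (simp only: mult_ac)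
  finally show ?thesis by (simp only: n_def)
qed

text \<open>The bound forces a zero of order at least \<open>N\<close> at \<open>1\<close>, which leaves room for no other root.\<close>

lemma order_bound_imp_no_root:
  fixes D :: "real poly"
  assumes D: "D \<noteq> 0" "degree D \<le> N" and d: "d \<ge> 1"
    and bound: "\<And>L. 0 < L \<Longrightarrow> L \<le> 1 \<Longrightarrow> \<bar>poly D (exp (real d * L))\<bar> \<le> C * L ^ N"
    and x: "x \<noteq> 1"
  shows "poly D x \<noteq> 0"
proof -
  define m where "m = order 1 D"
  obtain S where S: "D = [:-1, 1:] ^ m * S" "\<not> [:-1, 1:] dvd S"
    using order_decomp[OF D(1), of 1] by (auto simp: m_def)
  have S1: "poly S 1 \<noteq> 0" using S(2) by (simp add: poly_eq_0_iff_dvd)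
  have "N \<le> m"
  proof (rule ccontr)
    assume "\<not> N \<le> m"
    then have mN: "m < N" by simp
    \<comment> \<open>As \<open>exp (d * L) - 1 \<ge> L\<close>, dividing by \<open>L ^ m\<close>
      leaves a positive power of \<open>L\<close> in the bound; in the limit \<open>L = 0\<close>
      this forces \<open>poly S 1 = 0\<close>.\<close>
    have bS: "\<bar>poly S (exp (real d * L))\<bar> \<le> C * L ^ (N - m)" if L: "0 < L" "L \<le> 1" for L
    proof -
      have "L \<le> real d * L" using d L by simp
      then have "L \<le> exp (real d * L) - 1" using exp_ge_add_one_self[of "real d * L"] by linarith
      then have "L ^ m * \<bar>poly S (exp (real d * L))\<bar>
          \<le> (exp (real d * L) - 1) ^ m * \<bar>poly S (exp (real d * L))\<bar>"
        using L by (intro mult_right_mono power_mono) auto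
      also have "\<dots> = \<bar>poly D (exp (real d * L))\<bar>"
        using \<open>L \<le> exp (real d * L) - 1\<close> L by (simp add: S(1) abs_mult power_abs)
      also have "\<dots> \<le> C * L ^ N" using bound L by blast
      also have "\<dots> = L ^ m * (C * L ^ (N - m))"
        using mN by (simp add: power_add[symmetric])
      finally show ?thesis using L by simp
    qed
    have "((\<lambda>L. \<bar>poly S (exp (real d * L))\<bar>) \<longlongrightarrow> \<bar>poly S (exp (real d * 0))\<bar>) (at_right 0)"
      by (intro tendsto_intros)
    moreover have "((\<lambda>L. C * L ^ (N - m)) \<longlongrightarrow> C * 0 ^ (N - m)) (at_right (0::real))"
      by (intro tendsto_intros)
    moreover have "eventually (\<lambda>L. \<bar>poly S (exp (real d * L))\<bar> \<le> C * L ^ (N - m)) (at_right 0)"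
      unfolding eventually_at_right_field using bS by (intro exI[of _ 1]) auto
    ultimately have "\<bar>poly S (exp (real d * 0))\<bar> \<le> C * 0 ^ (N - m)"
      by (intro tendsto_le[OF trivial_limit_at_right_real])
    then show False using S1 mN by (simp add: power_0_left)
  qed
  have "S \<noteq> 0" using S1 by auto
  then have "degree D = m + degree S"
    unfolding S(1) by (subst degree_mult_eq) (auto simp: degree_power_eq)
  then have "degree S = 0" using D(2) \<open>N \<le> m\<close> by simp
  then obtain s where "S = [:s:]" by (metis degree_eq_zeroE)
  then show ?thesis using S x S1 by simp
qed

text \<open>The determinant \<open>D\<close> has degree at most \<open>2 * r + 1\<close> and, as a
  combination of two remainders, vanishes to that order at 1, so it has no other root. It is not the
  zero polynomial because its constant coefficient is nonzero. Hence two consecutive approximants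
  never agree at \<open>x \<noteq> 1\<close>.\<close>

lemma pade_det_nonzero:
  assumes d: "d \<ge> 2" and x: "x \<noteq> 1"
  shows "poly (padeP d r) x * poly (padeQ d (r + 1)) x \<noteq> poly (padeP d (r + 1)) x * poly (padeQ d r) x"
proof -
  define D where "D = padeP d r * padeQ d (r + 1) - padeP d (r + 1) * padeQ d r"
  have dP: "degree (padeP d s) \<le> s" "degree (padeQ d s) \<le> s" for s
    unfolding padeP_def padeQ_def
    by (intro degree_sum_le; auto intro: order.trans[OF degree_monom_le])+
  have deg: "degree D \<le> 2 * r + 1"
    unfolding D_def
    by (intro degree_diff_le; rule order.trans[OF degree_mult_le])
      (use dP[of r] dP[of "r + 1"] in auto)
  have P0: "poly (padeP d s) 0 = real d ^ s * prog_plus d s / fact s" for s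
    using prog_minus_pos[OF d, of s]
    by (simp add: poly_padeP power_0_left pade_def prog_plus_def if_distrib sum.delta cong: if_cong)
  have Q0: "poly (padeQ d s) 0 = real d ^ s * prog_minus d s / fact s" for s
    using prog_plus_pos[of d s]
    by (simp add: poly_padeQ power_0_left pade_def prog_minus_def if_distrib sum.delta cong: if_cong)
  have "poly D 0 = real d ^ r * real d ^ (r + 1) / (fact r * fact (r + 1))
      * (prog_plus d r * prog_minus d (r + 1) - prog_plus d (r + 1) * prog_minus d r)"
    by (simp only: D_def poly_diff poly_mult P0 Q0) (simp add: algebra_simps diff_divide_distrib)
  also have "prog_plus d r * prog_minus d (r + 1) - prog_plus d (r + 1) * prog_minus d r
      = - 2 * prog_plus d r * prog_minus d r"
    by (simp add: prog_plus_def prog_minus_def algebra_simps)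
  finally have "poly D 0 \<noteq> 0"
    using d prog_plus_pos[of d r] prog_minus_pos[OF d, of r] by simp
  then have D0: "D \<noteq> 0" by auto
  define K where "K = pade_const d"
  have K: "K \<ge> 0" by (simp add: K_def pade_const_def)
  define C where "C = poly (padeP d r) (exp (real d)) * K ^ (r + 2)
      + poly (padeP d (r + 1)) (exp (real d)) * K ^ (r + 1)"
  have "\<bar>poly D (exp (real d * L))\<bar> \<le> C * L ^ (2 * r + 1)" if L: "0 < L" "L \<le> 1" for L
  proof -
    define X where "X = exp (real d * L)"
    define E where "E s = exp L * poly (padeP d s) X - poly (padeQ d s) X" for s
    have E: "\<bar>E s\<bar> \<le> K ^ (s + 1) * L ^ (2 * s + 1)" for s
      using pade_remainder[OF d, of L s] L by (simp add: E_def X_def K_def)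
    have P: "\<bar>poly (padeP d s) X\<bar> \<le> poly (padeP d s) (exp (real d))" for s
    proof -
      have "0 \<le> poly (padeP d s) X"
        unfolding poly_padeP X_def using pade_bounds[OF d]
        by (auto intro!: sum_nonneg mult_nonneg_nonneg simp: less_imp_le)
      moreover have "poly (padeP d s) X \<le> poly (padeP d s) (exp (real d))"
        unfolding poly_padeP X_def using pade_bounds[OF d] L d
        by (auto intro!: sum_mono mult_left_mono power_mono simp: less_imp_le)
      ultimately show ?thesis by simp
    qed
    \<comment> \<open>Eliminates \<open>exp L\<close> between the remainders of orders
      \<open>r\<close> and \<open>r + 1\<close>.\<close>
    have "poly D X = poly (padeP d (r + 1)) X * E r - poly (padeP d r) X * E (r + 1)"
      by (simp add: D_def E_def algebra_simps)
    then have "\<bar>poly D X\<bar> \<le> \<bar>poly (padeP d (r + 1)) X\<bar> * \<bar>E r\<bar> + \<bar>poly (padeP d r) X\<bar> * \<bar>E (r + 1)\<bar>"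
      by (metis abs_mult abs_triangle_ineq4)
    also have "\<dots> \<le> poly (padeP d (r + 1)) (exp (real d)) * (K ^ (r + 1) * L ^ (2 * r + 1))
        + poly (padeP d r) (exp (real d)) * (K ^ (r + 2) * L ^ (2 * r + 1))"
    proof (intro add_mono mult_mono P E)
      have "L ^ (2 * (r + 1) + 1) \<le> L ^ (2 * r + 1)" using L by (intro power_decreasing) auto
      then have "K ^ (r + 2) * L ^ (2 * (r + 1) + 1) \<le> K ^ (r + 2) * L ^ (2 * r + 1)"
        using K by (intro mult_left_mono) auto
      with E[of "r + 1"] show "\<bar>E (r + 1)\<bar> \<le> K ^ (r + 2) * L ^ (2 * r + 1)" by simp
    qed (use order.trans[OF abs_ge_zero P] in auto)
    also have "\<dots> = C * L ^ (2 * r + 1)" by (simp add: C_def algebra_simps)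
    finally show ?thesis by (simp add: X_def)
  qed
  then have "poly D x \<noteq> 0"
    using order_bound_imp_no_root[OF D0 deg, of d C x] d x by auto
  then show ?thesis by (simp add: D_def)
qed

subsection \<open>Thue's theorem for binomial forms\<close>

text \<open>The summands are the two error terms of \<open>thue_gap\<close> at order
  \<open>s\<close>. Taking \<open>r\<close> least with \<open>(V / K) ^ r > 2 * K * Y\<close> makes
  the first small. Minimality gives
  \<open>V ^ (2 * r - 2) \<le> 4 * K ^ (2 * r) * Y\<^sup>2\<close>, which makes the second small
  because \<open>V \<ge> K ^ 20\<close> outweighs the powers of \<open>K\<close>.\<close>

lemma gap_exponent:
  fixes K V Y :: real
  assumes K: "K \<ge> 2" and V: "V \<ge> K ^ 20" and Y: "Y \<ge> V ^ 5"
  obtains r where "\<And>s. s = r \<or> s = r + 1 \<Longrightarrow>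
    Y * V * (K ^ (s + 1) / V ^ (s + 1)) + V * (K ^ (s + 1) * V ^ s) / Y\<^sup>2 < 1"
proof -
  have "K ^ 2 \<le> K ^ 20" using K by (intro power_increasing) auto
  then have KV: "K * K \<le> V" using V by (simp add: power2_eq_square)
  have "2 * K \<le> K * K" using K by simp
  then have V2: "2 * K \<le> V" using KV by linarith
  then have V1: "V > 1" using K by linarith
  have Y0: "Y > 0" using Y V1 by (smt (verit) zero_less_power)
  define W where "W = V / K"
  have W: "W \<ge> 2" using V2 K by (simp add: W_def field_simps)
  define r where "r = (LEAST r. 2 * K * Y < W ^ r)"
  have "\<exists>r. 2 * K * Y < W ^ r" using W by (intro real_arch_pow) auto
  then have r: "2 * K * Y < W ^ r" unfolding r_def by (rule LeastI_ex)
  have "V ^ 5 < V ^ r"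
  proof -
    have "Y \<le> 2 * K * Y" using K Y0 by simp
    moreover have "W ^ r \<le> V ^ r"
    proof (rule power_mono)
      have "V * 1 \<le> V * K" using K V1 by (intro mult_left_mono) auto
      then show "W \<le> V" using K by (simp add: W_def field_simps)
    qed (use W in auto)
    ultimately show ?thesis using r Y by linarith
  qed
  then have "5 < r" using V1 by simp
  \<comment> \<open>In terms of \<open>q\<close>, the exponent \<open>r - 1\<close> is
    \<open>q + 5\<close>, and \<open>s + 1 \<le> q + 8\<close> for both values of
    \<open>s\<close>.\<close>
  define q where "q = r - 6"
  have q: "r = q + 6" using \<open>5 < r\<close> by (simp add: q_def)
  have "\<not> 2 * K * Y < W ^ (q + 5)"
    using not_less_Least[of "q + 5" "\<lambda>r. 2 * K * Y < W ^ r"] q by (simp add: r_def[symmetric])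
  then have "(W ^ (q + 5))\<^sup>2 \<le> (2 * K * Y)\<^sup>2" using W by (intro power_mono) auto
  also have "(W ^ (q + 5))\<^sup>2 = V ^ (2 * q + 10) / K ^ (2 * q + 10)"
    by (simp add: W_def power_divide power_mult[symmetric] mult.commute)
  finally have "V ^ (2 * q + 10) \<le> (2 * K * Y)\<^sup>2 * K ^ (2 * q + 10)"
    using K by (simp add: pos_divide_le_eq)
  moreover have "K ^ (2 * q + 12) = K\<^sup>2 * K ^ (2 * q + 10)" by (simp add: add.commute flip: power_add)
  ultimately have VY: "V ^ (2 * q + 10) \<le> 4 * K ^ (2 * q + 12) * Y\<^sup>2"
    by (simp only: power_mult_distrib mult_ac) simp
  have small: "8 * K ^ (3 * q + 20) < V ^ (q + 2)"
  proof -
    have "2 ^ 3 \<le> K ^ 3" using K by (intro power_mono) auto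
    then have "8 * K ^ (3 * q + 20) \<le> K ^ 3 * K ^ (3 * q + 20)"
      using K by (intro mult_right_mono) auto
    also have "\<dots> = K ^ (3 * q + 23)" by (simp add: add.commute flip: power_add)
    also have "\<dots> < K ^ (20 * (q + 2))" using K by (intro power_strict_increasing) auto
    also have "\<dots> = (K ^ 20) ^ (q + 2)" by (rule power_mult)
    also have "\<dots> \<le> V ^ (q + 2)" using V K by (intro power_mono) auto
    finally show ?thesis .
  qed
  have second: "2 * (K ^ (q + 8) * V ^ (q + 8)) < Y\<^sup>2"
  proof -
    have "4 * K ^ (2 * q + 12) * (2 * (K ^ (q + 8) * V ^ (q + 8))) = 8 * K ^ (3 * q + 20) * V ^ (q + 8)"
      by (simp add: power_add[symmetric] algebra_simps)
    also have "\<dots> < V ^ (q + 2) * V ^ (q + 8)"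
      using small V1 by (intro mult_strict_right_mono) auto
    also have "\<dots> = V ^ ((q + 2) + (q + 8))" by (rule power_add[symmetric])
    also have "\<dots> = V ^ (2 * q + 10)" by (intro arg_cong[where f = "power V"]) simp
    also have "\<dots> \<le> 4 * K ^ (2 * q + 12) * Y\<^sup>2" by (rule VY)
    finally show ?thesis using K by (subst (asm) mult_less_cancel_left_pos) auto
  qed
  show thesis
  proof (rule that[of r])
    fix s assume s: "s = r \<or> s = r + 1"
    have "2 * K * Y < W ^ s"
    proof -
      have "W ^ r \<le> W ^ s" using W s by (intro power_increasing) auto
      then show ?thesis using r by linarith
    qed
    then have "2 * (Y * (K ^ (s + 1))) < V ^ s"
      using K by (simp add: W_def power_divide field_simps)
    then have "Y * V * (K ^ (s + 1) / V ^ (s + 1)) < 1 / 2"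
      using V1 by (simp add: field_simps)
    moreover have "V * (K ^ (s + 1) * V ^ s) / Y\<^sup>2 < 1 / 2"
    proof -
      have "V * (K ^ (s + 1) * V ^ s) = K ^ (s + 1) * V ^ (s + 1)" by simp
      also have "\<dots> \<le> K ^ (q + 8) * V ^ (q + 8)"
        using K V1 s q by (intro mult_mono power_increasing) auto
      finally show ?thesis using second Y0 by (simp add: field_simps)
    qed
    ultimately show "Y * V * (K ^ (s + 1) / V ^ (s + 1)) + V * (K ^ (s + 1) * V ^ s) / Y\<^sup>2 < 1"
      by linarith
  qed
qed

text \<open>The cofactor of \<open>x - y\<close> in \<open>x ^ d - y ^ d\<close> is a sum of
  nonnegative terms, one of which is \<open>y ^ (d - 1)\<close>.\<close>

lemma abs_diff_le_of_power_diff: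
  fixes x y :: real
  assumes "x > 0" "y > 0" "d \<ge> 1"
  shows "\<bar>x - y\<bar> * y ^ (d - 1) \<le> \<bar>x ^ d - y ^ d\<bar>"
proof -
  obtain e where e: "d = Suc e" using assms by (cases d) auto
  have "y ^ e \<le> (\<Sum>i<Suc e. x ^ i * y ^ (e - i))"
    using assms by (subst sum.lessThan_Suc_shift) (auto intro!: sum_nonneg)
  then have "\<bar>x - y\<bar> * y ^ e \<le> \<bar>x - y\<bar> * \<bar>\<Sum>i<Suc e. x ^ i * y ^ (e - i)\<bar>"
    by (intro mult_left_mono) auto
  also have "\<dots> = \<bar>x ^ d - y ^ d\<bar>"
    unfolding abs_mult[symmetric] e power_diff_sumr2[of x "Suc e" y]
    by (simp add: mult_ac)
  finally show ?thesis using e by simp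
qed

text \<open>Two solutions cannot be far apart: a large solution \<open>(x0, y0)\<close> yields good rational
  approximations to the \<open>d\<close>-th root of \<open>b / a\<close>, which repel the approximation coming from \<open>(x, y)\<close>.\<close>

lemma thue_gap:
  fixes a b d x0 y0 x y :: nat and c :: int
  assumes d: "d \<ge> 3" and ab: "a > 0" "b > 0" and c: "c \<noteq> 0"
    and K: "K = pade_const d * (real_of_int c)\<^sup>2"
    and sol0: "int a * int x0 ^ d - int b * int y0 ^ d = c"
    and sol: "int a * int x ^ d - int b * int y ^ d = c"
    and pos: "x0 > 0" "x > 0" "y > 0"
    and large: "real (b * y0 ^ d) \<ge> K ^ 20"
  shows "root d (real b) * real y < real (b * y0 ^ d) ^ 5"
proof (rule ccontr)
  assume contra: "\<not> ?thesis"
  define C where "C = \<bar>real_of_int c\<bar>"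
  have C: "C \<ge> 1" using c by (simp add: C_def)
  have d2: "d \<ge> 2" "d > 0" using d by auto
  have K1: "pade_const d \<ge> 16 * (real d)\<^sup>2 * 2" 
  proof -
    have "2 \<le> exp (2 * (real d + 1))" using exp_ge_add_one_self[of "2 * (real d + 1)"] by simp
    then have "16 * (real d)\<^sup>2 * 2 \<le> 16 * (real d)\<^sup>2 * exp (2 * (real d + 1))"
      by (intro mult_left_mono) auto
    then show ?thesis by (simp add: pade_const_def)
  qed
  have "1 \<le> (real d)\<^sup>2" using d by (simp add: one_le_power)
  then have K1': "pade_const d \<ge> 2" using K1 by linarith
  have KC: "K = pade_const d * C\<^sup>2" using K by (simp add: C_def)
  have C2: "1 \<le> C\<^sup>2" "C \<le> C\<^sup>2" using C by (auto simp: one_le_power self_le_power)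
  have "pade_const d * 1 \<le> K" unfolding KC using C2 K1' by (intro mult_left_mono) auto
  then have K2: "K \<ge> 2" "K \<ge> pade_const d" using K1' by auto
  have "2 * C\<^sup>2 \<le> K" unfolding KC using K1' C2 by (intro mult_right_mono) auto
  then have KC2: "2 * C \<le> K" using C2 by linarith
  define U V where "U = real (a * x0 ^ d)" and "V = real (b * y0 ^ d)"
  have "K ^ 1 \<le> K ^ 20" using K2 by (intro power_increasing) auto
  then have VC: "2 * C \<le> V" using large KC2 by (simp add: V_def)
  then have V: "V \<ge> 2" using C by linarith
  have UVc: "U - V = real_of_int c"
    using arg_cong[OF sol0, of real_of_int] by (simp add: U_def V_def)
  have y0: "y0 > 0" using V d2 by (cases "y0 = 0") (auto simp: V_def power_0_left)
  \<comment> \<open>Absorbing the roots of \<open>a\<close> and \<open>b\<close> into the variables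
    turns both equations into differences of pure \<open>d\<close>-th powers.\<close>
  define \<alpha> \<beta> where "\<alpha> = root d (real a)" and "\<beta> = root d (real b)"
  have ab1: "\<alpha> \<ge> 1" "\<beta> \<ge> 1" using ab d2 by (auto simp: \<alpha>_def \<beta>_def)
  have abd: "\<alpha> ^ d = real a" "\<beta> ^ d = real b" using d2 by (auto simp: \<alpha>_def \<beta>_def)
  define X0 Y0 X Y where "X0 = \<alpha> * real x0" and "Y0 = \<beta> * real y0"
    and "X = \<alpha> * real x" and "Y = \<beta> * real y"
  have "1 * 1 \<le> X0" "1 * 1 \<le> Y0" "1 * 1 \<le> X" "1 * 1 \<le> Y"
    unfolding X0_def Y0_def X_def Y_def using ab1 pos y0 by (intro mult_mono; simp)+
  then have ge1: "X0 \<ge> 1" "Y0 \<ge> 1" "X \<ge> 1" "Y \<ge> 1" by auto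
  have X0d: "X0 ^ d = U" "Y0 ^ d = V"
    using abd by (auto simp: X0_def Y0_def U_def V_def power_mult_distrib)
  have XYd: "X ^ d - Y ^ d = real_of_int c"
    using abd arg_cong[OF sol, of real_of_int] by (simp add: X_def Y_def power_mult_distrib)
  have Y0V: "Y0 \<le> V"
    using ge1 d2 power_increasing[of 1 d Y0] by (simp add: X0d(2)[symmetric])
  \<comment> \<open>Here \<open>d \<ge> 3\<close> provides the exponent 2 of \<open>Y\<close> on
    which \<open>gap_exponent\<close> relies.\<close>
  have XY: "\<bar>X - Y\<bar> \<le> C / Y\<^sup>2"
  proof -
    have "\<bar>X - Y\<bar> * Y\<^sup>2 \<le> \<bar>X - Y\<bar> * Y ^ (d - 1)"
      using ge1 d by (intro mult_left_mono power_increasing) auto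
    also have "\<dots> \<le> C"
      using abs_diff_le_of_power_diff[of X Y d] ge1 d2 XYd by (simp add: C_def)
    finally show ?thesis using ge1 by (simp add: pos_le_divide_eq)
  qed
  define L where "L = ln (X0 / Y0)"
  have expL: "exp L = X0 / Y0" using ge1 by (simp add: L_def)
  have expdL: "exp (real d * L) = U / V"
    unfolding exp_of_nat_mult expL by (simp add: power_divide X0d)
  have UVpos: "U / V > 0" using ge1 by (simp add: X0d[symmetric])
  have L: "\<bar>L\<bar> \<le> C / V"
  proof -
    define t where "t = real_of_int c / V"
    have t: "\<bar>t\<bar> = C / V" using V by (simp add: t_def C_def)
    have th: "\<bar>t\<bar> \<le> 1 / 2" using VC V by (simp add: t field_simps)
    have "U / V = 1 + t" using UVc V by (simp add: t_def field_simps)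
    then have "real d * L = ln (1 + t)" using expdL by (metis ln_exp)
    then have "real d * \<bar>L\<bar> = \<bar>ln (1 + t)\<bar>" by (metis abs_mult abs_of_nat)
    also have "\<dots> \<le> \<bar>t\<bar> + 2 * t\<^sup>2"
      using abs_ln_one_plus_x_minus_x_bound[OF th] by linarith
    also have "2 * t\<^sup>2 \<le> \<bar>t\<bar>"
      using mult_right_mono[OF th, of "\<bar>t\<bar>"] by (simp add: power2_eq_square abs_mult[symmetric])
    finally have "real d * \<bar>L\<bar> \<le> 2 * \<bar>t\<bar>" by simp
    moreover have "2 * \<bar>L\<bar> \<le> real d * \<bar>L\<bar>" using d by (intro mult_right_mono) auto
    ultimately show ?thesis using t by linarith
  qed
  have "C / V \<le> 1" using VC V C by simp
  then have L1: "\<bar>L\<bar> \<le> 1" using L by linarith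
  \<comment> \<open>The factor \<open>V ^ r\<close> clears the denominators of the powers of
    \<open>U / V\<close>, so both values are integers.\<close>
  define P Q where "P r = V ^ r * poly (padeP d r) (U / V)"
    and "Q r = V ^ r * poly (padeQ d r) (U / V)" for r
  have expand: "V ^ r * (\<Sum>j\<le>r. w j * (U / V) ^ j) = (\<Sum>j\<le>r. w j * U ^ j * V ^ (r - j))" for w r
  proof -
    have "V ^ r * (U / V) ^ j = U ^ j * V ^ (r - j)" if "j \<le> r" for j
      using that V by (simp add: power_divide power_diff)
    then show ?thesis by (simp add: sum_distrib_left mult.left_commute mult.assoc)
  qed
  have UVI: "U \<in> \<int>" "V \<in> \<int>" by (simp_all only: U_def V_def Ints_of_nat)
  have PI: "P r \<in> \<int>" for r
    unfolding P_def poly_padeP expand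
    using pade_bounds(1)[OF d2(1)] UVI Nats_subset_Ints
    by (intro Ints_sum Ints_mult Ints_power) auto
  have QI: "Q r \<in> \<int>" for r
    unfolding Q_def poly_padeQ expand
    using pade_bounds(1)[OF d2(1)] UVI Nats_subset_Ints
    by (intro Ints_sum Ints_mult Ints_power) auto
  have Qb: "\<bar>Q r\<bar> * C \<le> K ^ (r + 1) * V ^ r" for r
  proof -
    have "C \<le> V" using VC C by linarith
    then have "U \<le> 2 * V" using UVc abs_ge_self[of "real_of_int c"] unfolding C_def by linarith
    then have UV2: "U / V \<le> 2" using V by (simp add: field_simps)
    have "\<bar>poly (padeQ d r) (U / V)\<bar> \<le> (\<Sum>j\<le>r. \<bar>pade d r (r - j) * (U / V) ^ j\<bar>)"
      unfolding poly_padeQ by (rule sum_abs)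
    also have "\<dots> \<le> (\<Sum>j\<le>r. real (8 * d\<^sup>2) ^ r * 2 ^ r)"
    proof (rule sum_mono)
      fix j assume j: "j \<in> {..r}"
      have "(U / V) ^ j \<le> 2 ^ j" using UV2 UVpos by (intro power_mono) auto
      also have "\<dots> \<le> (2::real) ^ r" using j by (intro power_increasing) auto
      finally have "(U / V) ^ j \<le> 2 ^ r" .
      moreover have "0 \<le> pade d r (r - j)" "pade d r (r - j) \<le> real (8 * d\<^sup>2) ^ r"
        using pade_bounds[OF d2(1), of "r - j" r] by auto
      ultimately show "\<bar>pade d r (r - j) * (U / V) ^ j\<bar> \<le> real (8 * d\<^sup>2) ^ r * 2 ^ r"
        unfolding abs_mult using UVpos by (intro mult_mono) auto
    qed
    also have "\<dots> = (real r + 1) * (real (8 * d\<^sup>2) ^ r * 2 ^ r)" by (simp add: add.commute)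
    also have "\<dots> \<le> 2 ^ r * (real (8 * d\<^sup>2) ^ r * 2 ^ r)"
      by (intro mult_right_mono Suc_le_two_power) auto
    also have "\<dots> = (2 * (real (8 * d\<^sup>2) * 2)) ^ r" by (simp only: power_mult_distrib)
    also have "\<dots> \<le> pade_const d ^ r" using K1 by (intro power_mono) auto
    also have "\<dots> \<le> K ^ r" using K2 K1' by (intro power_mono) auto
    finally have "\<bar>poly (padeQ d r) (U / V)\<bar> * C \<le> K ^ r * K"
      using KC2 C K2 by (intro mult_mono) auto
    then have "V ^ r * (\<bar>poly (padeQ d r) (U / V)\<bar> * C) \<le> V ^ r * (K ^ r * K)"
      using V by (intro mult_left_mono) auto
    then show ?thesis using V by (simp add: Q_def abs_mult mult_ac)
  qed
  have E: "\<bar>X0 * P r - Y0 * Q r\<bar> \<le> V * (K ^ (r + 1) / V ^ (r + 1))" for r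
  proof -
    have "X0 * P r - Y0 * Q r = Y0 * V ^ r *
        (exp L * poly (padeP d r) (exp (real d * L)) - poly (padeQ d r) (exp (real d * L)))"
      using ge1 unfolding expL expdL by (simp add: P_def Q_def algebra_simps)
    then have "\<bar>X0 * P r - Y0 * Q r\<bar> = Y0 * V ^ r *
        \<bar>exp L * poly (padeP d r) (exp (real d * L)) - poly (padeQ d r) (exp (real d * L))\<bar>"
      using ge1 V by (simp add: abs_mult)
    also have "\<dots> \<le> Y0 * V ^ r * (pade_const d ^ (r + 1) * \<bar>L\<bar> ^ (2 * r + 1))"
      using pade_remainder[OF d2(1) L1] ge1 V by (intro mult_left_mono) auto
    also have "\<dots> \<le> V * V ^ r * (pade_const d ^ (r + 1) * (C / V) ^ (2 * r + 1))"
      using Y0V L V K1' ge1 by (intro mult_mono power_mono) auto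
    \<comment> \<open>Raising the exponent of \<open>C\<close> to the even number
      \<open>2 * (r + 1)\<close> lets it merge with \<open>pade_const d\<close> into a power of
      \<open>K = pade_const d * C\<^sup>2\<close>.\<close>
    also have "\<dots> \<le> V * V ^ r * (pade_const d ^ (r + 1) * (C ^ (2 * (r + 1)) / V ^ (2 * r + 1)))"
      unfolding power_divide
      using V C K1' by (intro mult_left_mono divide_right_mono power_increasing) auto
    also have "\<dots> = V * (K ^ (r + 1) * (V ^ r / V ^ (2 * r + 1)))"
      unfolding KC power_mult_distrib power_mult by (simp add: mult_ac)
    also have "V ^ r / V ^ (2 * r + 1) = 1 / V ^ (r + 1)"
    proof -
      have "V ^ (2 * r + 1) = V ^ r * V ^ (r + 1)" by (simp add: mult_2 flip: power_add)
      then show ?thesis using V by simp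
    qed
    finally show ?thesis by simp
  qed
  have Yl: "Y \<ge> V ^ 5" using contra by (simp add: Y_def \<beta>_def V_def)
  have Vl: "V \<ge> K ^ 20" using large by (simp add: V_def)
  obtain r where r: "\<And>s. s = r \<or> s = r + 1 \<Longrightarrow>
      Y * V * (K ^ (s + 1) / V ^ (s + 1)) + V * (K ^ (s + 1) * V ^ s) / Y\<^sup>2 < 1"
    using gap_exponent[OF K2(1) Vl Yl] by metis
  \<comment> \<open>The difference \<open>T\<close> of the two sides is an integer. Up to the factor
    \<open>\<alpha> * \<beta> \<ge> 1\<close> it is a combination of the Pade error and of
    \<open>X - Y\<close>, whose size is below 1 by the choice of \<open>r\<close>.\<close>
  have vanish: "real x0 * P s * real y = real y0 * Q s * real x" if s: "s = r \<or> s = r + 1" for s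
  proof (rule ccontr)
    define T where "T = real x0 * P s * real y - real y0 * Q s * real x"
    assume "real x0 * P s * real y \<noteq> real y0 * Q s * real x"
    then have "T \<noteq> 0" by (simp add: T_def)
    moreover have "T \<in> \<int>" unfolding T_def using PI QI by (intro Ints_diff Ints_mult) auto
    ultimately have "1 \<le> \<bar>T\<bar>" by (metis Ints_nonzero_abs_ge1)
    have "1 * 1 \<le> \<alpha> * \<beta>" using ab1 by (intro mult_mono) auto
    then have "1 * 1 \<le> (\<alpha> * \<beta>) * \<bar>T\<bar>" using \<open>1 \<le> \<bar>T\<bar>\<close> by (intro mult_mono) auto
    also have "\<dots> = \<bar>(\<alpha> * \<beta>) * T\<bar>" using ab1 by (simp add: abs_mult)
    also have "(\<alpha> * \<beta>) * T = Y * (X0 * P s - Y0 * Q s) - Y0 * Q s * (X - Y)"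
      by (simp add: T_def X0_def Y0_def X_def Y_def algebra_simps)
    also have "\<bar>\<dots>\<bar> \<le> \<bar>Y * (X0 * P s - Y0 * Q s)\<bar> + \<bar>Y0 * Q s * (X - Y)\<bar>"
      by (rule abs_triangle_ineq4)
    also have "\<dots> = Y * \<bar>X0 * P s - Y0 * Q s\<bar> + Y0 * (\<bar>Q s\<bar> * \<bar>X - Y\<bar>)"
      using ge1 by (simp add: abs_mult)
    also have "\<dots> \<le> Y * (V * (K ^ (s + 1) / V ^ (s + 1))) + V * (\<bar>Q s\<bar> * (C / Y\<^sup>2))"
      using E[of s] XY Y0V ge1 V by (intro add_mono mult_left_mono mult_mono) auto
    also have "V * (\<bar>Q s\<bar> * (C / Y\<^sup>2)) = V * (\<bar>Q s\<bar> * C) / Y\<^sup>2" by simp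
    also have "\<dots> \<le> V * (K ^ (s + 1) * V ^ s) / Y\<^sup>2"
      using Qb[of s] V by (intro divide_right_mono mult_left_mono) auto
    finally show False using r[OF s] unfolding mult.assoc by linarith
  qed
  \<comment> \<open>Both consecutive approximants are proportional to the same pair, so their
    determinant vanishes at \<open>U / V\<close>, although \<open>U / V \<noteq> 1\<close>.\<close>
  have "P r * Q (r + 1) = P (r + 1) * Q r"
  proof -
    have v1: "(real x0 * real y) * P r = (real y0 * real x) * Q r"
      and v2: "(real x0 * real y) * P (r + 1) = (real y0 * real x) * Q (r + 1)"
      using vanish[of r] vanish[of "r + 1"] by (auto simp: mult_ac)
    have "(real x0 * real y) * (real y0 * real x) * (P r * Q (r + 1))
      = (real x0 * real y * P r) * (real y0 * real x * Q (r + 1))" by (simp only: mult_ac)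
    also have "\<dots> = (real y0 * real x * Q r) * (real x0 * real y * P (r + 1))" by (simp only: v1 v2)
    also have "\<dots> = (real x0 * real y) * (real y0 * real x) * (P (r + 1) * Q r)" by (simp only: mult_ac)
    finally show ?thesis using pos y0 by simp
  qed
  then have "poly (padeP d r) (U / V) * poly (padeQ d (r + 1)) (U / V)
      = poly (padeP d (r + 1)) (U / V) * poly (padeQ d r) (U / V)"
    using V by (simp add: P_def Q_def)
  moreover have "U / V \<noteq> 1" using UVc c V by auto
  ultimately show False using pade_det_nonzero[OF d2(1)] by blast
qed

text \<open>A bound on \<open>y\<close> bounds \<open>x\<close> too. Either no solution has
  \<open>y\<close> beyond a threshold \<open>M\<close>, or one fixed solution
  \<open>(x0, y0)\<close> beyond it bounds \<open>y\<close> in all others through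
  \<open>thue_gap\<close>.\<close>

theorem thue_binomial_finite:
  fixes a b d :: nat and c :: int
  assumes d: "d \<ge> 3" and ab: "a > 0" "b > 0" and c: "c \<noteq> 0"
  shows "finite {(x::nat, y::nat). int a * int x ^ d - int b * int y ^ d = c}"
proof -
  define S where "S = {(x::nat, y::nat). int a * int x ^ d - int b * int y ^ d = c}"
  define K where "K = pade_const d * (real_of_int c)\<^sup>2"
  have fin: "finite {(x, y) \<in> S. y < M}" for M
  proof (rule finite_subset)
    have "x \<le> nat (\<bar>c\<bar> + int b * int M ^ d)" if "(x, y) \<in> S" "y < M" for x y
    proof -
      have "int x \<le> int x ^ d" using d by (cases "x = 0") (auto intro: self_le_power)
      also have "\<dots> \<le> int a * int x ^ d" using ab by (simp add: mult_le_cancel_right1)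
      also have "\<dots> = c + int b * int y ^ d" using that by (auto simp: S_def)
      also have "\<dots> \<le> \<bar>c\<bar> + int b * int M ^ d"
        using that by (intro add_mono mult_left_mono power_mono) auto
      finally show ?thesis by simp
    qed
    then show "{(x, y) \<in> S. y < M} \<subseteq> {..nat (\<bar>c\<bar> + int b * int M ^ d)} \<times> {..<M}" by auto
  qed simp
  \<comment> \<open>The summands ensure in turn the largeness needed by \<open>thue_gap\<close>,
    that \<open>x > 0\<close> whenever \<open>y \<ge> M\<close>, and that such \<open>y\<close> is
    positive.\<close>
  define M where "M = nat \<lceil>K ^ 20\<rceil> + nat \<bar>c\<bar> + 2"
  have M: "K ^ 20 \<le> real M" "\<bar>c\<bar> < int M"
    unfolding M_def by linarith+
  show ?thesis
  proof (cases "\<exists>x0 y0. (x0, y0) \<in> S \<and> y0 \<ge> M")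
    case False
    then have "S \<subseteq> {(x, y) \<in> S. y < M}" by force
    then have "finite S" by (rule finite_subset[OF _ fin])
    then show ?thesis by (simp only: S_def)
  next
    case True
    then obtain x0 y0 where s0: "(x0, y0) \<in> S" "y0 \<ge> M" by auto
    have grow: "y \<le> b * y ^ d" for y
    proof -
      have "y \<le> y ^ d" using d by (cases "y = 0") (auto intro: self_le_power)
      also have "\<dots> \<le> b * y ^ d" using ab by simp
      finally show ?thesis .
    qed
    have xpos: "x > 0" if "(x, y) \<in> S" "y \<ge> M" for x y
    proof (rule ccontr)
      assume "\<not> x > 0"
      then have "- c = int (b * y ^ d)" using that d by (auto simp: S_def)
      then show False using grow[of y] that M by linarith
    qed
    define N where "N = M + nat \<lceil>real (b * y0 ^ d) ^ 5\<rceil>"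
    have "y < N" if s: "(x, y) \<in> S" for x y
    proof (cases "y < M")
      case False
      have "real (b * y0 ^ d) \<ge> K ^ 20" using M s0 grow[of y0] by linarith
      then have "root d (real b) * real y < real (b * y0 ^ d) ^ 5"
        using s0 s False xpos[of x0 y0] xpos[of x y]
        by (intro thue_gap[OF d ab c K_def, of x0 y0 x y]) (auto simp: S_def M_def)
      moreover have "1 * real y \<le> root d (real b) * real y"
        using ab d by (intro mult_right_mono) auto
      ultimately show ?thesis unfolding N_def by linarith
    qed (simp add: N_def)
    then have "S \<subseteq> {(x, y) \<in> S. y < N}" by force
    then have "finite S" by (rule finite_subset[OF _ fin])
    then show ?thesis by (simp only: S_def)
  qed
qed

subsection \<open>Newton polygons\<close>

text \<open>For \<open>\<alpha> > 0\<close>, the indices minimizing this linear form over the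
  nonzero coefficients lie on the edge or vertex of the Newton polygon with supporting slope
  \<open>- \<mu> / \<alpha>\<close>. Two integers replace the rational slope.\<close>

definition newton_weight :: "int \<Rightarrow> int \<Rightarrow> int \<Rightarrow> int poly \<Rightarrow> nat \<Rightarrow> int" where
  "newton_weight p \<alpha> \<mu> f i = \<alpha> * int (multiplicity p (coeff f i)) + \<mu> * int i"

text \<open>A vertex of the Newton polygon. Zero coefficients are excluded explicitly because
  \<open>multiplicity\<close> assigns them 0 instead of infinity.\<close>

definition strict_newton_min :: "int \<Rightarrow> int \<Rightarrow> int \<Rightarrow> int poly \<Rightarrow> nat \<Rightarrow> bool" where
  "strict_newton_min p \<alpha> \<mu> f i \<longleftrightarrow> coeff f i \<noteq> 0 \<and>
     (\<forall>j. j \<noteq> i \<longrightarrow> coeff f j \<noteq> 0 \<longrightarrow> newton_weight p \<alpha> \<mu> f i < newton_weight p \<alpha> \<mu> f j)"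

lemma strict_newton_min_unique:
  "strict_newton_min p \<alpha> \<mu> f i \<Longrightarrow> strict_newton_min p \<alpha> \<mu> f j \<Longrightarrow> i = j"
  unfolding strict_newton_min_def by (metis less_asym)

text \<open>As in Gauss's lemma, the pair \<open>(i0, j0)\<close> alone attains the least weight
  among all products of coefficients, so nothing can cancel it in the coefficient at
  \<open>i0 + j0\<close>, and every other coefficient has larger weight.\<close>

lemma strict_newton_min_mult:
  assumes p: "prime p" and \<alpha>: "\<alpha> > 0"
    and G: "strict_newton_min p \<alpha> \<mu> g i0" and H: "strict_newton_min p \<alpha> \<mu> h j0"
  shows "strict_newton_min p \<alpha> \<mu> (g * h) (i0 + j0)"
proof -
  define W where "W = newton_weight p \<alpha> \<mu>"
  define m where "m = W g i0 + W h j0"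
  have pu: "\<not> is_unit p" using p not_prime_unit by blast
  have g0: "coeff g i0 \<noteq> 0" and h0: "coeff h j0 \<noteq> 0"
    using G H by (auto simp: strict_newton_min_def)
  have wsum: "W g i + W h j = \<alpha> * int (multiplicity p (coeff g i * coeff h j)) + \<mu> * int (i + j)"
    if "coeff g i \<noteq> 0" "coeff h j \<noteq> 0" for i j
  proof -
    have "multiplicity p (coeff g i * coeff h j) = multiplicity p (coeff g i) + multiplicity p (coeff h j)"
      using that p by (intro prime_elem_multiplicity_mult_distrib prime_imp_prime_elem)
    then show ?thesis by (simp add: W_def newton_weight_def distrib_left)
  qed
  have gr: "m < W g i + W h j" if "coeff g i \<noteq> 0" "coeff h j \<noteq> 0" "(i, j) \<noteq> (i0, j0)" for i j
  proof -
    have "i \<noteq> i0 \<Longrightarrow> W g i0 < W g i" "j \<noteq> j0 \<Longrightarrow> W h j0 < W h j"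
      using G H that by (auto simp: strict_newton_min_def W_def)
    then show ?thesis using that(3) by (cases "i = i0"; cases "j = j0") (auto simp: m_def)
  qed
  \<comment> \<open>One divisibility for two purposes: it separates the leading term within the
    coefficient at \<open>i0 + j0\<close>, and it excludes other coefficients of weight at most
    \<open>m\<close>.\<close>
  have dvd: "p ^ Suc v dvd coeff g i * coeff h j"
    if "\<alpha> * int v + \<mu> * int (i + j) \<le> m" "(i, j) \<noteq> (i0, j0)" for i j v
  proof (cases "coeff g i = 0 \<or> coeff h j = 0")
    case False
    then have "\<alpha> * int v < \<alpha> * int (multiplicity p (coeff g i * coeff h j))"
      using gr[of i j] wsum[of i j] that by linarith
    then have "v < multiplicity p (coeff g i * coeff h j)" using \<alpha> by simp
    then show ?thesis by (intro multiplicity_dvd') auto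
  qed auto
  define v0 where "v0 = multiplicity p (coeff g i0 * coeff h j0)"
  have m: "m = \<alpha> * int v0 + \<mu> * int (i0 + j0)"
    using wsum[OF g0 h0] by (simp add: m_def v0_def)
  have c0: "coeff (g * h) (i0 + j0) = coeff g i0 * coeff h j0
      + (\<Sum>i\<in>{..i0 + j0} - {i0}. coeff g i * coeff h (i0 + j0 - i))"
    unfolding coeff_mult by (subst sum.remove[of _ i0]) auto
  have rest: "p ^ Suc v0 dvd (\<Sum>i\<in>{..i0 + j0} - {i0}. coeff g i * coeff h (i0 + j0 - i))"
    by (intro dvd_sum dvd) (auto simp: m)
  have "p ^ v0 dvd coeff g i0 * coeff h j0" unfolding v0_def by (rule multiplicity_dvd)
  moreover have nd: "\<not> p ^ Suc v0 dvd coeff g i0 * coeff h j0"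
    unfolding v0_def using g0 h0 pu by (subst power_dvd_iff_le_multiplicity) auto
  ultimately have "p ^ v0 dvd coeff (g * h) (i0 + j0)" "\<not> p ^ Suc v0 dvd coeff (g * h) (i0 + j0)"
    unfolding c0 using rest dvd_add_left_iff[OF rest] power_le_dvd[OF rest, of v0] by auto
  then have mult: "multiplicity p (coeff (g * h) (i0 + j0)) = v0" and nz: "coeff (g * h) (i0 + j0) \<noteq> 0"
    by (auto intro: multiplicity_eqI)
  then have Wm: "W (g * h) (i0 + j0) = m" by (simp add: W_def newton_weight_def m)
  have "m < W (g * h) l" if l: "l \<noteq> i0 + j0" "coeff (g * h) l \<noteq> 0" for l
  proof (rule ccontr)
    define v where "v = multiplicity p (coeff (g * h) l)"
    assume "\<not> m < W (g * h) l"
    then have "\<alpha> * int v + \<mu> * int l \<le> m" by (simp add: W_def newton_weight_def v_def)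
    then have "p ^ Suc v dvd (\<Sum>i\<le>l. coeff g i * coeff h (l - i))"
      using l by (intro dvd_sum dvd) auto
    then have "p ^ Suc v dvd coeff (g * h) l" by (simp only: coeff_mult)
    then have "Suc v \<le> v" unfolding v_def using l pu by (subst power_dvd_iff_le_multiplicity[symmetric]) auto
    then show False by simp
  qed
  then show ?thesis using nz Wm by (auto simp: strict_newton_min_def W_def)
qed

text \<open>The perturbation breaks ties: equal perturbed weights at \<open>i\<close> and
  \<open>j\<close> would make \<open>N\<close> divide \<open>j - i\<close>, although both indices
  are below \<open>N\<close>.\<close>

lemma strict_newton_min_exists:
  assumes f: "f \<noteq> 0" and N: "int (degree f) < N" and \<epsilon>: "\<epsilon> = 1 \<or> \<epsilon> = - 1"
  obtains i where "strict_newton_min p (N * \<alpha>) (N * \<mu> + \<epsilon>) f i"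
proof -
  define W where "W = newton_weight p (N * \<alpha>) (N * \<mu> + \<epsilon>) f"
  define S where "S = {i. coeff f i \<noteq> 0}"
  have S: "finite S" "S \<noteq> {}"
  proof -
    have "S \<subseteq> {..degree f}" by (auto simp: S_def le_degree)
    then show "finite S" using finite_subset by blast
    show "S \<noteq> {}" using f leading_coeff_0_iff[of f] unfolding S_def by blast
  qed
  have inj: "i = j" if ij: "i \<in> S" "j \<in> S" "W i = W j" for i j
  proof -
    have "W i = N * newton_weight p \<alpha> \<mu> f i + \<epsilon> * int i" for i
      by (simp add: W_def newton_weight_def algebra_simps)
    then have "N * (newton_weight p \<alpha> \<mu> f i - newton_weight p \<alpha> \<mu> f j) = \<epsilon> * (int j - int i)"
      using ij(3) by (simp add: algebra_simps)
    then have "N dvd \<epsilon> * (int j - int i)" by (metis dvd_triv_left)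
    then have "N dvd int j - int i" using \<epsilon> by (auto simp: dvd_diff_commute)
    moreover have "i \<le> degree f" "j \<le> degree f" using ij by (auto simp: S_def le_degree)
    then have "\<bar>int j - int i\<bar> < N" using N by linarith
    ultimately show ?thesis using zdvd_not_zless[of "\<bar>int j - int i\<bar>" N] by (cases "i = j") auto
  qed
  define i where "i = arg_min_on W S"
  have "i \<in> S \<and> (\<forall>j\<in>S. W i \<le> W j)"
    using arg_min_if_finite[OF S, of W] by (auto simp: i_def not_less)
  moreover have "W i < W j" if "j \<in> S" "j \<noteq> i" for j
    using inj[of i j] calculation that by (auto simp: order_less_le)
  ultimately have "strict_newton_min p (N * \<alpha>) (N * \<mu> + \<epsilon>) f i"
    by (simp add: strict_newton_min_def W_def S_def)
  then show thesis by (rule that)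
qed

text \<open>Dumas' theorem for a single edge: the segment of the Newton polygon of a product with a given
  slope is the sum of the segments of that slope of the factors. Perturbing the slope by
  \<open>\<plusminus> 1 / N\<close> singles out the left and the right end of an edge.\<close>

lemma newton_edge:
  assumes p: "prime p" and \<alpha>: "\<alpha> > 0" and gh: "g * h \<noteq> 0"
    and nz: "coeff (g * h) lo \<noteq> 0" "coeff (g * h) hi \<noteq> 0"
    and val: "newton_weight p \<alpha> \<mu> (g * h) lo = m" "newton_weight p \<alpha> \<mu> (g * h) hi = m"
    and le: "\<And>i. coeff (g * h) i \<noteq> 0 \<Longrightarrow> m \<le> newton_weight p \<alpha> \<mu> (g * h) i"
    and ends: "\<And>i. coeff (g * h) i \<noteq> 0 \<Longrightarrow> newton_weight p \<alpha> \<mu> (g * h) i = m \<Longrightarrow> lo \<le> i \<and> i \<le> hi"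
  obtains i i' j j' where "i + i' = lo" "j + j' = hi" "i \<le> degree g" "j \<le> degree g"
    "i' \<le> degree h" "j' \<le> degree h" "\<alpha> dvd \<mu> * (int j - int i)"
proof -
  define N where "N = int (degree (g * h)) + 1"
  define W where "W = newton_weight p \<alpha> \<mu>"
  have g0: "g \<noteq> 0" and h0: "h \<noteq> 0" using gh by auto
  have N: "N > 0" "N * \<alpha> > 0" "int (degree g) < N" "int (degree h) < N"
    using \<alpha> g0 h0 by (auto simp: N_def degree_mult_eq)
  have W': "newton_weight p (N * \<alpha>) (N * \<mu> + \<epsilon>) f i = N * W f i + \<epsilon> * int i" for \<epsilon> f i
    by (simp add: W_def newton_weight_def algebra_simps)
  \<comment> \<open>Weights are integers, so a point off the edge exceeds the minimum by at least
    \<open>N\<close> after scaling, more than the perturbation can compensate.\<close>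
  have step: "N * m + N \<le> N * W (g * h) i" if "coeff (g * h) i \<noteq> 0" "W (g * h) i \<noteq> m" for i
  proof -
    have "m + 1 \<le> W (g * h) i" using le[OF that(1)] that(2) by (simp add: W_def)
    then have "N * (m + 1) \<le> N * W (g * h) i" using N by (intro mult_left_mono) auto
    then show ?thesis by (simp add: algebra_simps)
  qed
  have dg: "int i < N" if "coeff (g * h) i \<noteq> 0" for i
    using le_degree[OF that] by (simp add: N_def)
  have "strict_newton_min p (N * \<alpha>) (N * \<mu> + 1) (g * h) lo"
    unfolding strict_newton_min_def W'
  proof (intro conjI allI impI)
    fix i assume i: "i \<noteq> lo" "coeff (g * h) i \<noteq> 0"
    show "N * W (g * h) lo + 1 * int lo < N * W (g * h) i + 1 * int i"
    proof (cases "W (g * h) i = m")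
      case True
      then have "lo \<le> i" using ends[of i] i by (simp add: W_def)
      then show ?thesis using True i val by (simp add: W_def)
    next
      case False
      then show ?thesis using step[OF i(2)] dg[OF nz(1)] val by (simp add: W_def)
    qed
  qed (rule nz)
  moreover obtain i where i: "strict_newton_min p (N * \<alpha>) (N * \<mu> + 1) g i"
    using strict_newton_min_exists[OF g0 N(3)] by blast
  moreover obtain i' where i': "strict_newton_min p (N * \<alpha>) (N * \<mu> + 1) h i'"
    using strict_newton_min_exists[OF h0 N(4)] by blast
  ultimately have lo: "i + i' = lo"
    using strict_newton_min_mult[OF p N(2)] strict_newton_min_unique by blast
  have "strict_newton_min p (N * \<alpha>) (N * \<mu> + - 1) (g * h) hi"
    unfolding strict_newton_min_def W'
  proof (intro conjI allI impI)
    fix i assume i: "i \<noteq> hi" "coeff (g * h) i \<noteq> 0"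
    show "N * W (g * h) hi + - 1 * int hi < N * W (g * h) i + - 1 * int i"
    proof (cases "W (g * h) i = m")
      case True
      then have "i \<le> hi" using ends[of i] i by (simp add: W_def)
      then show ?thesis using True i val by (simp add: W_def)
    next
      case False
      then show ?thesis using step[OF i(2)] dg[OF i(2)] val by (simp add: W_def)
    qed
  qed (rule nz)
  moreover obtain j where j: "strict_newton_min p (N * \<alpha>) (N * \<mu> + - 1) g j"
    using strict_newton_min_exists[OF g0 N(3)] by blast
  moreover obtain j' where j': "strict_newton_min p (N * \<alpha>) (N * \<mu> + - 1) h j'"
    using strict_newton_min_exists[OF h0 N(4)] by blast
  ultimately have hi: "j + j' = hi"
    using strict_newton_min_mult[OF p N(2)] strict_newton_min_unique by blast
  have cg: "coeff g i \<noteq> 0" "coeff g j \<noteq> 0" "coeff h i' \<noteq> 0" "coeff h j' \<noteq> 0"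
    using i i' j j' by (auto simp: strict_newton_min_def)
  then have deg: "i \<le> degree g" "j \<le> degree g" "i' \<le> degree h" "j' \<le> degree h"
    by (auto intro: le_degree)
  \<comment> \<open>The ends minimize weights perturbed by less than \<open>N\<close>, so the
    integral unperturbed weights differ by less than 1.\<close>
  have "W g i = W g j"
  proof (cases "i = j")
    case False
    have "N * W g i + int i < N * W g j + int j" "N * W g j - int j < N * W g i - int i"
      using i j cg False unfolding strict_newton_min_def W' by fastforce+
    then have "N * W g i < N * W g j + N * 1" "N * W g j < N * W g i + N * 1" using deg N by linarith+
    then have "N * W g i < N * (W g j + 1)" "N * W g j < N * (W g i + 1)"
      by (simp_all add: distrib_left)
    then have "W g i < W g j + 1" "W g j < W g i + 1" using N by simp_all
    then show ?thesis by simp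
  qed simp
  then have "\<mu> * (int j - int i) = \<alpha> * (int (multiplicity p (coeff g i)) - int (multiplicity p (coeff g j)))"
    by (simp add: W_def newton_weight_def algebra_simps)
  then have "\<alpha> dvd \<mu> * (int j - int i)" by simp
  with lo hi deg show thesis by (intro that)
qed

section \<open>Newton polygons with a single low point\<close>

text \<open>The shape of \<open>F\<close> at one prime: all points have the same height except the
  one at \<open>j\<close>, which lies lower by \<open>e\<close>. The common shift
  \<open>\<delta>\<close> allows for a constant factor from clearing denominators.\<close>

locale newton_profile =
  fixes p :: int and g h :: "int poly" and k e \<delta> j :: nat
  assumes p: "prime p" and k: "k \<ge> 3" and deg: "degree (g * h) = k" and j: "j \<le> k"
    and nonzero: "i \<le> k \<Longrightarrow> coeff (g * h) i \<noteq> 0"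
    and val: "i \<le> k \<Longrightarrow> multiplicity p (coeff (g * h) i) = \<delta> + (if i = j then 0 else e)"
    and e: "e > 0"
begin

lemma product_nonzero: "g * h \<noteq> 0"
  using deg k by auto

lemma degree_sum: "degree g + degree h = k"
  using product_nonzero deg degree_mult_eq[of g h] by auto

lemma weight:
  "i \<le> k \<Longrightarrow> newton_weight p \<alpha> \<mu> (g * h) i
     = \<alpha> * int \<delta> + ((if i = j then 0 else \<alpha> * int e) + \<mu> * int i)"
  by (simp add: newton_weight_def val algebra_simps)

text \<open>\<open>newton_edge\<close> with the contribution of \<open>\<delta>\<close> removed, for
  an edge that meets the points only at its two ends.\<close>

lemma edge:
  assumes \<alpha>: "\<alpha> > 0" and lohi: "lo \<le> k" "hi \<le> k"
    and mlo: "(if lo = j then 0 else \<alpha> * int e) + \<mu> * int lo = m"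
    and mhi: "(if hi = j then 0 else \<alpha> * int e) + \<mu> * int hi = m"
    and le: "\<And>i. i \<le> k \<Longrightarrow> i \<noteq> lo \<Longrightarrow> i \<noteq> hi \<Longrightarrow>
      m < (if i = j then 0 else \<alpha> * int e) + \<mu> * int i"
    and lh: "lo \<le> hi"
  obtains i i' l l' where "i + i' = lo" "l + l' = hi" "i \<le> degree g" "l \<le> degree g"
    "i' \<le> degree h" "l' \<le> degree h" "\<alpha> dvd \<mu> * (int l - int i)"
proof (rule newton_edge[OF p \<alpha> product_nonzero])
  have i: "i \<le> k" if "coeff (g * h) i \<noteq> 0" for i using le_degree[OF that] deg by simp
  show "newton_weight p \<alpha> \<mu> (g * h) lo = \<alpha> * int \<delta> + m"
    "newton_weight p \<alpha> \<mu> (g * h) hi = \<alpha> * int \<delta> + m"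
    using weight[OF lohi(1)] weight[OF lohi(2)] mlo mhi by simp_all
  show "\<alpha> * int \<delta> + m \<le> newton_weight p \<alpha> \<mu> (g * h) i" if "coeff (g * h) i \<noteq> 0" for i
    unfolding weight[OF i[OF that]] using le[OF i[OF that]] mlo mhi by (cases "i = lo"; cases "i = hi") auto
  show "lo \<le> i \<and> i \<le> hi" if "coeff (g * h) i \<noteq> 0"
    "newton_weight p \<alpha> \<mu> (g * h) i = \<alpha> * int \<delta> + m" for i
  proof -
    have "i = lo \<or> i = hi"
      using that(2) unfolding weight[OF i[OF that(1)]] using le[OF i[OF that(1)]] by force
    then show ?thesis using lh by auto
  qed
qed (use nonzero lohi that in auto)

text \<open>Here the Newton polygon is one edge of width \<open>k\<close> and height
  \<open>e\<close>. The part belonging to \<open>g\<close> has width \<open>degree g\<close> and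
  must have integral height.\<close>

lemma end_dvd:
  assumes "j = 0 \<or> j = k"
  shows "k dvd e * degree g"
  using assms
proof
  assume j0: "j = 0"
  obtain i i' l l' where il: "i + i' = 0" "l + l' = k" "l \<le> degree g" "l' \<le> degree h"
      "int k dvd (- int e) * (int l - int i)"
  proof (rule edge[of "int k" 0 k "- int e" 0])
    fix i assume i: "i \<le> k" "i \<noteq> 0" "i \<noteq> k"
    then have "int e * int i < int e * int k" using e by (intro mult_strict_left_mono) auto
    then show "0 < (if i = j then 0 else int k * int e) + - int e * int i"
      using j0 i by (simp add: mult.commute)
  qed (use k j0 in auto)
  then have "l = degree g" "i = 0" using degree_sum by auto
  then have "int k dvd int (e * degree g)" using il(5) by simp
  then show ?thesis by (simp only: of_nat_dvd_iff)
next
  assume jk: "j = k"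
  obtain i i' l l' where il: "i + i' = 0" "l + l' = k" "l \<le> degree g" "l' \<le> degree h"
      "int k dvd int e * (int l - int i)"
  proof (rule edge[of "int k" 0 k "int e" "int k * int e"])
    fix i assume i: "i \<le> k" "i \<noteq> 0" "i \<noteq> k"
    then have "0 < int e * int i" using e by simp
    then show "int k * int e < (if i = j then 0 else int k * int e) + int e * int i"
      using jk i by simp
  qed (use k jk in auto)
  then have "l = degree g" "i = 0" using degree_sum by auto
  then have "int k dvd int (e * degree g)" using il(5) by simp
  then show ?thesis by (simp only: of_nat_dvd_iff)
qed

text \<open>Now there is an edge of width \<open>k - 1\<close> and height \<open>e\<close> next to
  one of width 1, so \<open>g\<close> occupies width \<open>t\<close> on the long edge with
  \<open>t\<close> equal to \<open>degree g\<close> or one less. As \<open>2 * degree g = k\<close>,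
  the numbers \<open>k - 1\<close> and \<open>2 * t\<close> differ by 1, so \<open>t\<close> is
  coprime to \<open>k - 1\<close>.\<close>

lemma inner_dvd:
  assumes "j = 1 \<or> j = k - 1" and half: "2 * degree g = k"
  shows "(k - 1) dvd e"
proof -
  have "\<exists>t. (t = degree g \<or> t + 1 = degree g) \<and> int (k - 1) dvd int e * int t"
    using assms(1)
  proof
    assume j1: "j = 1"
    have right: "int (k - 1) * int e + - int e * int k = - int e"
      using k by (simp add: of_nat_diff algebra_simps)
    obtain i i' l l' where il: "i + i' = 1" "l + l' = k" "l \<le> degree g" "l' \<le> degree h"
      "i \<le> degree g" "int (k - 1) dvd (- int e) * (int l - int i)"
    proof (rule edge[of "int (k - 1)" 1 k "- int e" "- int e"])
      fix i assume i: "i \<le> k" "i \<noteq> 1" "i \<noteq> k"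
      then have "int e * int i < int e * int k" using e by (intro mult_strict_left_mono) auto
      then show "- int e < (if i = j then 0 else int (k - 1) * int e) + - int e * int i"
        using j1 i k by (simp add: of_nat_diff algebra_simps)
    qed (use k j1 right in auto)
    then have "l = degree g" "i = 0 \<or> i = 1" using degree_sum by auto
    moreover have "int (k - 1) dvd int e * (int l - int i)" using il(6) by simp
    ultimately show ?thesis using il(5)
      by (intro exI[of _ "degree g - i"]) (auto simp: of_nat_diff)
  next
    assume jk: "j = k - 1"
    obtain i i' l l' where il: "i + i' = 0" "l + l' = k - 1" "l \<le> degree g" "l' \<le> degree h"
      "int (k - 1) dvd int e * (int l - int i)"
    proof (rule edge[of "int (k - 1)" 0 "k - 1" "int e" "int (k - 1) * int e"])
      fix i assume i: "i \<le> k" "i \<noteq> 0" "i \<noteq> k - 1"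
      then have "0 < int e * int i" using e by simp
      then show "int (k - 1) * int e < (if i = j then 0 else int (k - 1) * int e) + int e * int i"
        using jk i by simp
    qed (use k jk in auto)
    then have "l = degree g \<or> l + 1 = degree g" "i = 0" using degree_sum by auto
    then show ?thesis using il(5) by auto
  qed
  then obtain t where t: "t = degree g \<or> t + 1 = degree g" "int (k - 1) dvd int e * int t" by blast
  have "coprime (int (k - 1)) (int t)"
  proof -
    have "2 * t = k \<or> 2 * t + 2 = k" using t(1) half by auto
    then have "int (k - 1) - 2 * int t = 1 \<or> int (k - 1) - 2 * int t = - 1" using k by auto
    then show ?thesis by (intro coprimeI) (metis dvd_diff dvd_mult dvd_minus_iff minus_minus)
  qed
  then have "int (k - 1) dvd int e" using t(2) coprime_dvd_mult_left_iff by blast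
  then show ?thesis by (simp only: of_nat_dvd_iff)
qed

end

subsection \<open>Irreducibility\<close>

lemma multiplicity_int_nat:
  fixes q n :: nat
  assumes "prime q" "n > 0"
  shows "multiplicity (int q) (int n) = multiplicity q n"
proof (rule multiplicity_eqI)
  have "\<not> is_unit q" using assms(1) not_prime_unit by blast
  then have "\<not> q ^ Suc (multiplicity q n) dvd n"
    using assms(2) by (subst power_dvd_iff_le_multiplicity) auto
  then show "\<not> int q ^ Suc (multiplicity q n) dvd int n"
    by (metis of_nat_dvd_iff of_nat_power)
  have "q ^ multiplicity q n dvd n" by (rule multiplicity_dvd)
  then show "int q ^ multiplicity q n dvd int n"
    by (metis of_nat_dvd_iff of_nat_power)
qed

text \<open>Multiplication by \<open>fact (n - k - 1)\<close> completes both sides to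
  \<open>fact n\<close>.\<close>

lemma c_coeff_nat_identity:
  assumes "k < n" "j \<le> k"
  shows "fact j * fact (k - j) * ((n choose j) * ((n - j - 1) choose (k - j))) * (n - j)
       = (\<Prod>i\<le>k. n - i :: nat)"
proof -
  have tail: "(\<Prod>i\<le>m. n - i) * fact (n - m - 1) = (fact n :: nat)" if "m < n" for m
    using that
  proof (induction m)
    case 0
    then show ?case by (cases n) auto
  next
    case (Suc m)
    then have "fact (n - m - 1) = (n - Suc m) * (fact (n - Suc m - 1) :: nat)"
      by (subst fact_reduce) auto
    then show ?case using Suc by (simp add: mult_ac)
  qed
  have 1: "fact j * fact (n - j) * (n choose j) = (fact n :: nat)"
    using assms by (intro binomial_fact_lemma) simp
  have 2: "fact (n - j) = (n - j) * (fact (n - j - 1) :: nat)"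
    using assms by (subst fact_reduce) auto
  have "fact (k - j) * fact (n - j - 1 - (k - j)) * ((n - j - 1) choose (k - j)) = (fact (n - j - 1) :: nat)"
    using assms by (intro binomial_fact_lemma) simp
  moreover have "n - j - 1 - (k - j) = n - k - 1" using assms by simp
  ultimately have 3: "fact (k - j) * fact (n - k - 1) * ((n - j - 1) choose (k - j)) = (fact (n - j - 1) :: nat)"
    by (simp only:)
  have "fact j * fact (k - j) * ((n choose j) * ((n - j - 1) choose (k - j))) * (n - j) * fact (n - k - 1)
      = fact j * ((n - j) * fact (n - j - 1)) * (n choose j)"
    unfolding 3[symmetric] by (simp only: mult_ac)
  also have "\<dots> = (\<Prod>i\<le>k. n - i) * fact (n - k - 1)"
    using tail[OF assms(1)] 1 2 by simp
  finally show ?thesis by simp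
qed

text \<open>A prime \<open>q > k\<close> divides neither factorial in
  \<open>c_coeff_nat_identity\<close>, nor any \<open>n - l\<close> with \<open>l \<le> k\<close>
  other than \<open>n - j\<close>, since \<open>q\<close> exceeds the differences of these
  numbers.\<close>

lemma multiplicity_binomials:
  fixes q :: nat
  assumes kn: "k < n" and i: "i \<le> k" and j: "j \<le> k"
    and q: "prime q" "q > k" "q dvd n - j"
  shows "multiplicity q ((n choose i) * ((n - i - 1) choose (k - i)))
    = (if i = j then 0 else multiplicity q (n - j))"
proof -
  define B where "B = (n choose i) * ((n - i - 1) choose (k - i))"
  have pe: "prime_elem q" using q by (intro prime_imp_prime_elem)
  have B0: "B > 0" using kn i by (auto simp: B_def)
  have others: "multiplicity q (n - l) = 0" if "l \<le> k" "l \<noteq> j" for l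
  proof (rule not_dvd_imp_multiplicity_0)
    show "\<not> q dvd n - l"
    proof
      assume "q dvd n - l"
      then have "int q dvd int (n - l) - int (n - j)" using q(3) by (intro dvd_diff) auto
      also have "int (n - l) - int (n - j) = int j - int l" using that j kn by simp
      finally have "int q dvd \<bar>int j - int l\<bar>" by simp
      then show False using that j q(2) zdvd_imp_le[of "int q" "\<bar>int j - int l\<bar>"] by auto
    qed
  qed
  have f: "multiplicity q (fact s) = 0" if "s \<le> k" for s :: nat
    using that q by (intro not_dvd_imp_multiplicity_0) (simp add: prime_dvd_fact_iff)
  have "multiplicity q (\<Prod>l\<le>k. n - l) = (\<Sum>l\<le>k. multiplicity q (n - l))"
    using q kn by (intro prime_elem_multiplicity_prod_distrib) auto
  also have "\<dots> = multiplicity q (n - j)"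
    using j others by (subst sum.remove[of _ j]) auto
  finally have "multiplicity q (fact i * fact (k - i) * B * (n - i)) = multiplicity q (n - j)"
    using c_coeff_nat_identity[OF kn i] by (simp add: B_def)
  then have "multiplicity q B + multiplicity q (n - i) = multiplicity q (n - j)"
    using pe B0 i kn f[of i] f[of "k - i"] by (simp add: prime_elem_multiplicity_mult_distrib)
  then show ?thesis using others[OF i] unfolding B_def by auto
qed

lemma clear_denominators:
  fixes g :: "rat poly"
  obtains D :: int and g' :: "int poly" where "D \<noteq> 0" "\<And>i. of_int (coeff g' i) = of_int D * coeff g i"
proof -
  have "\<exists>D (g' :: int poly). D \<noteq> 0 \<and> (\<forall>i. of_int (coeff g' i) = of_int D * coeff g i)"
  proof (induction g)
    case 0
    show ?case by (intro exI[of _ 1] exI[of _ 0]) simp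
  next
    case (pCons a g)
    then obtain D g' where IH: "D \<noteq> 0" "\<And>i. of_int (coeff g' i) = of_int D * coeff g i" by blast
    obtain u v where uv: "v \<noteq> 0" "of_int v * a = of_int u"
    proof -
      obtain u v where "quotient_of a = (u, v)" by (cases "quotient_of a")
      then have "a = of_int u / of_int v" "v > 0"
        by (auto simp: quotient_of_div quotient_of_denom_pos)
      then show thesis by (intro that[of v u]) auto
    qed
    have "of_int (coeff (pCons (D * u) (smult v g')) i) = of_int (D * v) * coeff (pCons a g) i" for i
      using uv(2) IH(2) by (cases i) (auto simp: mult_ac)
    then show ?case using IH(1) uv(1) by (intro exI[of _ "D * v"]) auto
  qed
  then show thesis using that by blast
qed

lemma degree_cong_support:
  "(\<And>i. coeff f i = 0 \<longleftrightarrow> coeff g i = 0) \<Longrightarrow> degree f = degree g"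
  by (simp add: degree_def)

lemma coeff_F_poly:
  "coeff (F_poly a n k) i = (if i \<le> k then of_int (a i * c_coeff n k i) else 0)"
  by (simp add: F_poly_def coeff_sum coeff_monom sum.delta)

text \<open>One pair of integer multiples of \<open>G\<close> and \<open>H\<close> serves all primes
  \<open>q > k\<close>. The cleared denominators shift every valuation equally, and the
  \<open>a i\<close> are prime to \<open>q\<close> by smoothness.\<close>

lemma factor_profile:
  assumes k: "k \<ge> 3" "k < n" and a: "\<forall>j\<le>k. smooth_int k (a j)"
    and F: "F_poly a n k = G * H"
  obtains g h :: "int poly" where "degree g = degree G" "degree h = degree H"
    "\<And>q j. prime q \<Longrightarrow> q > k \<Longrightarrow> j \<le> k \<Longrightarrow> q dvd n - j \<Longrightarrow>
      \<exists>\<delta>. newton_profile (int q) g h k (multiplicity q (n - j)) \<delta> j"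
proof -
  obtain D g where g: "D \<noteq> 0" "\<And>i. of_int (coeff g i) = of_int D * coeff G i"
    using clear_denominators by blast
  obtain E h where h: "E \<noteq> 0" "\<And>i. of_int (coeff h i) = of_int E * coeff H i"
    using clear_denominators by blast
  have c: "coeff (g * h) i = D * E * (if i \<le> k then a i * c_coeff n k i else 0)" for i
  proof -
    have "(of_int (coeff (g * h) i) :: rat) = of_int D * of_int E * coeff (G * H) i"
      unfolding coeff_mult of_int_sum sum_distrib_left
      by (intro sum.cong refl) (simp add: g h)
    also have "\<dots> = of_int (D * E * (if i \<le> k then a i * c_coeff n k i else 0))"
      by (simp add: F[symmetric] coeff_F_poly)
    finally show ?thesis by (simp only: of_int_eq_iff)
  qed
  have nz: "a i \<noteq> 0" "c_coeff n k i \<noteq> 0" if "i \<le> k" for i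
    using a that k by (auto simp: smooth_int_def c_coeff_def)
  have degF: "degree (g * h) = k"
    using nz[of k] g(1) h(1) by (intro antisym degree_le le_degree) (auto simp: c)
  show thesis
  proof (rule that[of g h])
    show "degree g = degree G"
      by (rule degree_cong_support) (metis g mult_eq_0_iff of_int_eq_0_iff)
    show "degree h = degree H"
      by (rule degree_cong_support) (metis h mult_eq_0_iff of_int_eq_0_iff)
    fix q j assume q: "prime q" "q > k" and j: "j \<le> k" "q dvd n - j"
    have pe: "prime_elem (int q)" using q by (intro prime_imp_prime_elem) simp
    have va: "multiplicity (int q) (a i) = 0" if "i \<le> k" for i
    proof (rule not_dvd_imp_multiplicity_0)
      show "\<not> int q dvd a i"
      proof
        assume "int q dvd a i"
        then have "int q \<in> prime_factors (a i)" using nz[OF that] q by (simp add: in_prime_factors_iff)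
        then have "int q \<le> int k" using a that unfolding smooth_int_def by blast
        then show False using q by simp
      qed
    qed
    have vc: "multiplicity (int q) (c_coeff n k i) = (if i = j then 0 else multiplicity q (n - j))"
      if i: "i \<le> k" for i
    proof -
      define B where "B = (n choose i) * ((n - i - 1) choose (k - i))"
      have "c_coeff n k i = int B * (- 1) ^ (k - i)" by (simp add: c_coeff_def B_def)
      then have "c_coeff n k i = int B \<or> c_coeff n k i = - int B"
        by (cases "even (k - i)") auto
      then have "multiplicity (int q) (c_coeff n k i) = multiplicity (int q) (int B)" by auto
      also have "\<dots> = multiplicity q B"
        using q k i by (intro multiplicity_int_nat) (auto simp: B_def)
      finally show ?thesis using multiplicity_binomials[OF k(2) i j(1) q j(2)] by (simp add: B_def)
    qed
    have "newton_profile (int q) g h k (multiplicity q (n - j)) (multiplicity (int q) (D * E)) j"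
    proof
      fix i assume i: "i \<le> k"
      show "coeff (g * h) i \<noteq> 0" using nz[OF i] g(1) h(1) i by (simp add: c)
      have "multiplicity (int q) (D * E * (a i * c_coeff n k i))
          = multiplicity (int q) (D * E) + (multiplicity (int q) (a i) + multiplicity (int q) (c_coeff n k i))"
        using pe nz[OF i] g(1) h(1)
        by (subst prime_elem_multiplicity_mult_distrib, simp_all del: mult_eq_0_iff)
          (simp_all add: prime_elem_multiplicity_mult_distrib)
      then show "multiplicity (int q) (coeff (g * h) i)
          = multiplicity (int q) (D * E) + (if i = j then 0 else multiplicity q (n - j))"
        using i va[OF i] vc[OF i] by (simp add: c)
    next
      have "n - j > 0" using j k by simp
      moreover have "\<not> is_unit q" using q not_prime_unit by blast
      ultimately show "0 < multiplicity q (n - j)" using j(2) by (simp add: multiplicity_gt_zero_iff)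
    qed (use q k degF j in auto)
    then show "\<exists>\<delta>. newton_profile (int q) g h k (multiplicity q (n - j)) \<delta> j" by blast
  qed
qed

section \<open>Integers that are powers up to a bounded factor\<close>

text \<open>\<open>m\<close> collects the prime exponents reduced modulo \<open>d\<close>; primes
  above \<open>k\<close> drop out, and the others divide into a product of \<open>d\<close>-th
  powers of distinct numbers up to \<open>k\<close>.\<close>

lemma bounded_times_power:
  fixes N d k :: nat
  assumes N: "N > 0" and d: "d > 0" and dv: "\<And>q. prime q \<Longrightarrow> q > k \<Longrightarrow> d dvd multiplicity q N"
  obtains m y where "N = m * y ^ d" "0 < m" "m \<le> fact k ^ d"
proof -
  define P where "P = prime_factors N"
  define v where "v q = multiplicity q N" for q
  define m where "m = (\<Prod>q\<in>P. q ^ (v q mod d))"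
  define y where "y = (\<Prod>q\<in>P. q ^ (v q div d))"
  have fin: "finite P" by (simp add: P_def)
  have pr: "prime q" if "q \<in> P" for q using that by (auto simp: P_def)
  have "N = (\<Prod>q\<in>P. q ^ v q)"
    using N by (simp add: P_def v_def prime_factorization_nat[symmetric])
  also have "\<dots> = (\<Prod>q\<in>P. q ^ (v q mod d) * (q ^ (v q div d)) ^ d)"
    by (intro prod.cong refl) (simp flip: power_mult power_add)
  also have "\<dots> = m * y ^ d" by (simp add: m_def y_def prod.distrib prod_power_distrib)
  finally have "N = m * y ^ d" .
  moreover have "0 < m" using \<open>N = m * y ^ d\<close> N by (metis gr0I mult_0)
  moreover have "m \<le> fact k ^ d"
  proof -
    have "m = (\<Prod>q\<in>{q \<in> P. q \<le> k}. q ^ (v q mod d))"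
      unfolding m_def
      by (intro prod.mono_neutral_right fin) (use pr dv in \<open>auto simp: v_def not_le\<close>)
    also have "\<dots> \<le> (\<Prod>q\<in>{q \<in> P. q \<le> k}. q ^ d)"
    proof (intro prod_mono conjI)
      fix q assume "q \<in> {q \<in> P. q \<le> k}"
      then have "q \<ge> 1" using pr[of q] prime_gt_0_nat[of q] by simp
      then show "q ^ (v q mod d) \<le> q ^ d"
        using d by (intro power_increasing) (auto simp: less_imp_le)
    qed simp
    also have "\<dots> \<le> (\<Prod>q\<in>{1..k}. q ^ d)"
    proof (intro dvd_imp_le prod_dvd_prod_subset)
      show "{q \<in> P. q \<le> k} \<subseteq> {1..k}" using pr prime_gt_0_nat by (auto simp: Suc_le_eq)
    qed (auto intro!: prod_pos)
    also have "\<dots> = fact k ^ d" by (simp add: fact_prod prod_power_distrib)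
    finally show ?thesis .
  qed
  ultimately show thesis by (rule that)
qed

text \<open>Writing \<open>A = m * x ^ d\<close> and \<open>B = m' * y ^ d\<close> with bounded
  \<open>m\<close> and \<open>m'\<close> leaves finitely many Thue equations, each with finitely
  many solutions.\<close>

lemma near_powers_bounded:
  fixes d k :: nat and c :: int
  assumes d: "d \<ge> 3" and c: "c \<noteq> 0"
  shows "\<exists>n1. \<forall>A B. A > 0 \<longrightarrow> B > 0 \<longrightarrow> int A - int B = c \<longrightarrow>
    (\<forall>q. prime q \<longrightarrow> q > k \<longrightarrow> d dvd multiplicity q A \<and> d dvd multiplicity q B) \<longrightarrow> A < n1"
proof -
  define M :: nat where "M = fact k ^ d"
  define S where "S m m' = {(x::nat, y::nat). int m * int x ^ d - int m' * int y ^ d = c}" for m m'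
  define T where "T = (\<Union>m\<in>{1..M}. \<Union>m'\<in>{1..M}. (\<lambda>(x, y). m * x ^ d) ` S m m')"
  have "finite T"
    unfolding T_def S_def using thue_binomial_finite[OF d _ _ c] by auto
  then obtain n1 where n1: "\<And>t. t \<in> T \<Longrightarrow> t < n1"
    using finite_nat_set_iff_bounded by metis
  show ?thesis
  proof (intro exI[of _ n1] allI impI)
    fix A B :: nat
    assume AB: "A > 0" "B > 0" "int A - int B = c"
      "\<forall>q. prime q \<longrightarrow> q > k \<longrightarrow> d dvd multiplicity q A \<and> d dvd multiplicity q B"
    obtain m x where m: "A = m * x ^ d" "0 < m" "m \<le> M"
      using bounded_times_power[of A d k] AB d by (auto simp: M_def)
    obtain m' y where m': "B = m' * y ^ d" "0 < m'" "m' \<le> M"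
      using bounded_times_power[of B d k] AB d by (auto simp: M_def)
    have "(x, y) \<in> S m m'" using AB(3) m m' by (simp add: S_def)
    then have "A \<in> T" unfolding T_def using m m' by force
    then show "A < n1" by (rule n1)
  qed
qed

theorem theorem3:
  fixes k :: nat
  assumes "k \<ge> 3"
  shows "\<exists>n0::nat. \<forall>n\<ge>n0. \<forall>a :: nat \<Rightarrow> int.
           (\<forall>j\<le>k. smooth_int k (a j)) \<longrightarrow> irreducible (F_poly a n k)"
proof -
  have "\<exists>n1. \<forall>d c A B. d \<ge> 3 \<longrightarrow> c \<noteq> 0 \<longrightarrow> A > 0 \<longrightarrow> B > 0 \<longrightarrow> int A - int B = c \<longrightarrow>
    (\<forall>q. prime q \<longrightarrow> q > k \<longrightarrow> d dvd multiplicity q A \<and> d dvd multiplicity q B) \<longrightarrow> A < n1 d c"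
    using near_powers_bounded[of _ _ k] by metis
  then obtain n1 :: "nat \<Rightarrow> int \<Rightarrow> nat" where n1: "\<And>d c A B. d \<ge> 3 \<Longrightarrow> c \<noteq> 0 \<Longrightarrow> A > 0 \<Longrightarrow> B > 0 \<Longrightarrow>
      int A - int B = c \<Longrightarrow>
      (\<And>q. prime q \<Longrightarrow> q > k \<Longrightarrow> d dvd multiplicity q A \<and> d dvd multiplicity q B) \<Longrightarrow> A < n1 d c"
    by metis
  \<comment> \<open>The sum covers every possible exponent \<open>d \<le> k\<close> for the pair
    \<open>n\<close>, \<open>n - k\<close>; the next term serves the pair \<open>n - 1\<close>,
    \<open>n - k + 1\<close> with exponent \<open>k - 1\<close>.\<close>
  define n0 where "n0 = (\<Sum>d\<le>k. n1 d (int k)) + n1 (k - 1) (int k - 2) + k + 1"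
  show ?thesis
  proof (intro exI[of _ n0] allI impI)
    fix n a assume n: "n \<ge> n0" and a: "\<forall>j\<le>k. smooth_int k (a j)"
    have kn: "k < n" using n by (simp add: n0_def)
    have degF: "degree (F_poly a n k) = k"
    proof (intro antisym degree_le le_degree)
      show "coeff (F_poly a n k) k \<noteq> 0"
        using a kn by (auto simp: coeff_F_poly smooth_int_def c_coeff_def)
    qed (simp add: coeff_F_poly)
    show "irreducible (F_poly a n k)"
    proof (rule irreducibleI)
      show F0: "F_poly a n k \<noteq> 0" using degF assms by auto
      show "\<not> is_unit (F_poly a n k)" using degF assms by (simp add: is_unit_iff_degree[OF F0])
    next
      fix G H assume F: "F_poly a n k = G * H"
      show "is_unit G \<or> is_unit H"
      proof (rule ccontr)
        assume nu: "\<not> (is_unit G \<or> is_unit H)"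
        have GH: "G * H \<noteq> 0" using F degF assms by auto
        then have dsum: "degree G + degree H = k" using F degF degree_mult_eq[of G H] by auto
        have "degree G > 0" "degree H > 0" using nu GH by (auto simp: is_unit_iff_degree)
        define r where "r = degree G"
        have r: "0 < r" "r < k" using \<open>degree G > 0\<close> \<open>degree H > 0\<close> dsum by (auto simp: r_def)
        obtain g h where gh: "degree g = degree G" "degree h = degree H" and
          prof: "\<And>q j. prime q \<Longrightarrow> q > k \<Longrightarrow> j \<le> k \<Longrightarrow> q dvd n - j \<Longrightarrow>
            \<exists>\<delta>. newton_profile (int q) g h k (multiplicity q (n - j)) \<delta> j"
          using factor_profile[OF assms kn a F] by metis
        have ends: "k dvd multiplicity q (n - j) * r"
          if qj: "prime q" "q > k" "j = 0 \<or> j = k" for q j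
        proof (cases "q dvd n - j")
          case True
          then obtain \<delta> where "newton_profile (int q) g h k (multiplicity q (n - j)) \<delta> j"
            using prof[of q j] qj by auto
          from newton_profile.end_dvd[OF this qj(3)] show ?thesis by (simp add: gh r_def)
        qed (simp add: not_dvd_imp_multiplicity_0)
        \<comment> \<open>Dividing by \<open>gcd k r\<close> turns \<open>k dvd e * r\<close> into
          \<open>d dvd e\<close>.\<close>
        define d where "d = k div gcd k r"
        have dk: "k = d * gcd k r" by (simp add: d_def)
        have cop: "coprime d (r div gcd k r)"
          unfolding d_def using r by (intro div_gcd_coprime) auto
        have ends': "d dvd multiplicity q (n - j)" if "prime q" "q > k" "j = 0 \<or> j = k" for q j
        proof -
          have "d * gcd k r dvd multiplicity q (n - j) * (r div gcd k r) * gcd k r"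
            using ends[OF that] dk by (simp add: mult.assoc)
          then have "d dvd multiplicity q (n - j) * (r div gcd k r)" using r by simp
          then show ?thesis using cop coprime_dvd_mult_left_iff by blast
        qed
        show False
        proof (cases "d \<ge> 3")
          case True
          have "n < n1 d (int k)"
            using ends'[of _ 0] ends'[of _ k] True kn assms by (intro n1[of d "int k" n "n - k"]) auto
          moreover have "d \<le> k" by (simp add: d_def)
          then have "n1 d (int k) \<le> (\<Sum>d\<le>k. n1 d (int k))"
            by (intro member_le_sum) auto
          ultimately show False using n by (simp add: n0_def)
        next
          case False
          have "gcd k r \<le> r" using r by (intro gcd_le2_nat) auto
          then have "gcd k r < k" using r by linarith
          then have "d \<noteq> 1" using dk by (metis mult_1 less_irrefl)
          moreover have "d \<noteq> 0" using dk r by (metis mult_0 not_less0)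
          ultimately have "d = 2" using False by linarith
          then have k2: "k = 2 * gcd k r" using dk by simp
          have "r = gcd k r"
          proof -
            obtain t where t: "r = gcd k r * t" by (metis dvdE gcd_dvd2)
            have "gcd k r * t < gcd k r * 2" using r(2) k2 t by linarith
            then have "t < 2" by simp
            then have "t = 1" using t r by (cases t) auto
            then show ?thesis using t by simp
          qed
          then have half: "2 * degree g = k" using k2 by (simp add: gh r_def)
          \<comment> \<open>\<open>k\<close> is even here, hence at least 4, so that the exponent
            \<open>k - 1\<close> is at least 3 and the difference \<open>k - 2\<close> is
            nonzero.\<close>
          then have k4: "k \<ge> 4" using assms by presburger
          have inner: "(k - 1) dvd multiplicity q (n - j)"
            if qj: "prime q" "q > k" "j = 1 \<or> j = k - 1" for q j
          proof (cases "q dvd n - j")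
            case True
            then obtain \<delta> where "newton_profile (int q) g h k (multiplicity q (n - j)) \<delta> j"
              using prof[of q j] qj assms by auto
            from newton_profile.inner_dvd[OF this qj(3) half] show ?thesis .
          qed (simp add: not_dvd_imp_multiplicity_0)
          have "n - 1 < n1 (k - 1) (int k - 2)"
            using inner[of _ 1] inner[of _ "k - 1"] k4 kn
            by (intro n1[of "k - 1" "int k - 2" "n - 1" "n - (k - 1)"]) (auto simp: of_nat_diff)
          then show False using n k4 by (simp add: n0_def)
        qed
      qed
    qed
  qed
qed

end
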